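(* For every fixed integer $k \geq 3$ there is a constant $C_k>0$ such that for every integer $r \geq 2$ and every sufficiently large $n$, \[\hat{R}\left( \mathcal{P}_{n,k-1}^{(k)}, r\right) \leq C_k\, r^{k} (n \log n)^{k/2}.\] That is, $\hat{R}\left( \mathcal{P}_{n,k-1}^{(k)}, r\right) = O\left( r^{k} (n \log n)^{k/2}\right)$.
   Context: A $k$-uniform hypergraph $\mathcal{G}$ is a vertex set $V(\mathcal{G})$ together with a family $E(\mathcal{G})$ of $k$-element subsets (edges). For $k$-uniform hypergraphs $\mathcal{G},\mathcal{H}$ and an integer $r\ge 2$, write $\mathcal{H}\to(\mathcal{G})_r$ if every coloring of the edges of $\mathcal{H}$ with $r$ colors contains a monochromatic copy of $\mathcal{G}$. The $r$-color size-Ramsey number is $\hat{R}(\mathcal{G},r)=\min\{|E(\mathcal{H})| : \mathcal{H}\to(\mathcal{G})_r\}$. The $k$-uniform tight path $\mathcal{P}_{n,k-1}^{(k)}$ is the $k$-uniform hypergraph with vertex set $[n]=\{1,\dots,n\}$ whose edges are the $n-k+1$ intervals $\{i,i+1,\dots,i+k-1\}$, $1\le i\le n-k+1$. $\log$ denotes the natural logarithm. *)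

theory Defs
  imports Complex_Main "HOL-Library.Ramsey"
begin

record 'a hypergraph =
  verts :: "'a set"
  edges :: "'a set set"

definition uniform_hypergraph :: "nat \<Rightarrow> 'a hypergraph \<Rightarrow> bool" where
  "uniform_hypergraph k H \<longleftrightarrow> edges H \<subseteq> nsets (verts H) k"

text \<open>A copy is not necessarily induced: it is an injection of the vertices that
  maps edges to edges.\<close>

definition monochromatic_copy ::
  "'a hypergraph \<Rightarrow> 'b hypergraph \<Rightarrow> ('b set \<Rightarrow> nat) \<Rightarrow> bool" where
  "monochromatic_copy G H f \<longleftrightarrow>
     (\<exists>\<phi> c. inj_on \<phi> (verts G) \<and> \<phi> ` verts G \<subseteq> verts H \<and>
            (\<forall>e\<in>edges G. \<phi> ` e \<in> edges H \<and> f (\<phi> ` e) = c))"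

definition arrows :: "'b hypergraph \<Rightarrow> 'a hypergraph \<Rightarrow> nat \<Rightarrow> bool" where
  "arrows H G r \<longleftrightarrow> (\<forall>f \<in> edges H \<rightarrow> {..<r}. monochromatic_copy G H f)"

text \<open>Only hosts with finitely many edges matter for the minimum, but finiteness has to be
  required because \<^const>\<open>card\<close> is 0 on infinite sets. Such hosts can be taken on
  natural-number vertices. The infimum is a minimum by
  \<open>size_Ramsey_attained\<close> below.\<close>

definition size_Ramsey :: "nat \<Rightarrow> 'a hypergraph \<Rightarrow> nat \<Rightarrow> nat" where
  "size_Ramsey k G r =
     Inf {card (edges H) | H :: nat hypergraph.
            uniform_hypergraph k H \<and> finite (edges H) \<and> arrows H G r}"

definition tight_path :: "nat \<Rightarrow> nat \<Rightarrow> nat hypergraph" where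
  "tight_path k n =
     \<lparr>verts = {1..n}, edges = {{i..<i + k} | i. 1 \<le> i \<and> i + k \<le> n + 1}\<rparr>"

lemma ex_arrows:
  fixes G :: "'a hypergraph"
  assumes G: "uniform_hypergraph k G" "finite (verts G)"
  shows "\<exists>H :: nat hypergraph. uniform_hypergraph k H \<and> finite (edges H) \<and> arrows H G r"
proof -
  define m where "m = card (verts G)"
  obtain N :: nat where N: "partn_lst {..<N} (replicate r m) k"
    using ramsey_full by blast
  define H :: "nat hypergraph" where "H = \<lparr>verts = {..<N}, edges = nsets {..<N} k\<rparr>"
  have "arrows H G r"
    unfolding arrows_def
  proof
    fix f assume "f \<in> edges H \<rightarrow> {..<r}"
    then have "f \<in> nsets {..<N} k \<rightarrow> {..<length (replicate r m)}"
      by (simp add: H_def)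
    with N obtain i S where
      i: "i < r" and S: "S \<in> nsets {..<N} (replicate r m ! i)"
      and mono: "f ` nsets S k \<subseteq> {i}"
      unfolding partn_lst_def monochromatic_def by (metis length_replicate)
    from i S have S': "S \<subseteq> {..<N}" "finite S" "card S = m" by (auto simp: nsets_def)
    then obtain \<phi> where \<phi>: "bij_betw \<phi> (verts G) S"
      using G(2) finite_same_card_bij m_def by metis
    have "\<phi> ` e \<in> nsets S k" if "e \<in> edges G" for e
    proof -
      have e: "e \<subseteq> verts G" "finite e" "card e = k"
        using that G(1) by (auto simp: uniform_hypergraph_def nsets_def)
      moreover have "card (\<phi> ` e) = card e"
        using \<phi> e(1) by (meson bij_betw_def card_image inj_on_subset)
      ultimately show ?thesis using \<phi> by (auto simp: nsets_def bij_betw_def)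
    qed
    moreover have "nsets S k \<subseteq> nsets {..<N} k" using S'(1) by (auto simp: nsets_def)
    ultimately show "monochromatic_copy G H f"
      unfolding monochromatic_copy_def H_def using \<phi> S'(1) mono[unfolded image_subset_iff]
      by (intro exI[of _ \<phi>] exI[of _ i]) (auto simp: bij_betw_def image_subset_iff)
  qed
  then show ?thesis
    by (intro exI[of _ H]) (auto simp: H_def uniform_hypergraph_def finite_imp_finite_nsets)
qed

lemma size_Ramsey_attained:
  fixes G :: "'a hypergraph"
  assumes "uniform_hypergraph k G" "finite (verts G)"
  obtains H :: "nat hypergraph" where
    "uniform_hypergraph k H" "finite (edges H)" "arrows H G r"
    "card (edges H) = size_Ramsey k G r"
proof -
  let ?K = "{card (edges H) | H :: nat hypergraph.
            uniform_hypergraph k H \<and> finite (edges H) \<and> arrows H G r}"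
  have "?K \<noteq> {}" using ex_arrows[OF assms] by auto
  then have "size_Ramsey k G r \<in> ?K" unfolding size_Ramsey_def by (rule Inf_nat_def1)
  then show ?thesis using that by force
qed

lemma uniform_hypergraph_tight_path:
  "uniform_hypergraph k (tight_path k n)" "finite (verts (tight_path k n))"
  by (auto simp: uniform_hypergraph_def tight_path_def nsets_def)

end

theory Submission
  imports Defs "HOL-Library.Disjoint_Sets"
begin

text \<open>Take vertex classes \<open>V\<^sub>0, \<dots>, V\<^sub>k\<^sub>-\<^sub>1\<close> of size \<open>N\<close>, a multiple of \<open>r n\<close>, and join
  cyclically consecutive classes by random bipartite graphs of density \<open>p\<close>, where \<open>d = N p\<^sup>2\<close>
  is a multiple of \<open>r ln N\<close>. The host has the vertex sets of the transversal \<open>k\<close>-cycles as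
  edges, about \<open>(N p)\<^sup>k\<close> of them; the possible extensions of a \<open>(k-1)\<close>-set are the about \<open>d\<close>
  common neighbours of its two ends. Given a colouring, the most frequent colour contains a family in
  which every shadow set keeps at least \<open>\<epsilon> d\<close> extensions, with \<open>\<epsilon>\<close> of order \<open>1 / r\<close>. A
  depth-first search for a tight path in this family moves the ends at which it gets stuck to the
  trash; these are disjoint and have all their extensions inside the visited set. By a Chernoff bound,
  no set of at most \<open>\<epsilon> N / 4\<close> vertices contains \<open>\<epsilon> d\<close> common neighbours for each of about
  \<open>N / ln N\<close> disjoint pairs, so the search discards few vertices and reaches length \<open>n\<close>.\<close>

section \<open>Depth-first search for tight paths\<close>

definition shadow :: "'a set set \<Rightarrow> 'a set set" where
  "shadow F = {t. \<exists>w. w \<notin> t \<and> insert w t \<in> F}"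

text \<open>Lists let the path grow and be cut at its right end. A list shorter than
  \<open>k\<close> satisfies the edge condition vacuously, so the search separately keeps track of
  \<open>k \<le> length p\<close>.\<close>

definition tight_list :: "'a set set \<Rightarrow> nat \<Rightarrow> 'a list \<Rightarrow> bool" where
  "tight_list F k p \<longleftrightarrow>
     distinct p \<and> (\<forall>j. j + k \<le> length p \<longrightarrow> (!) p ` {j..<j + k} \<in> F)"

lemma tight_list_appendD:
  assumes "tight_list F k (p @ q)"
  shows "tight_list F k p"
  unfolding tight_list_def
proof (intro conjI allI impI)
  show "distinct p"
    using assms by (simp add: tight_list_def)
  fix j assume j: "j + k \<le> length p"
  have "(!) (p @ q) ` {j..<j + k} = (!) p ` {j..<j + k}"
    using j by (intro image_cong) (auto simp: nth_append)
  then show "(!) p ` {j..<j + k} \<in> F"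
    using assms j by (auto simp: tight_list_def dest!: spec[of _ j])
qed

lemma nth_image_append: "(!) (q @ ys) ` {length q..<length q + length ys} = set ys"
proof -
  have "(!) (q @ ys) ` (+) (length q) ` {0..<length ys} = (!) ys ` {0..<length ys}"
    by (simp only: image_image nth_append_length_plus)
  then show ?thesis by (simp add: nth_image add.commute)
qed

text \<open>The window starting at \<open>length q\<close> is the only one that contains
  \<open>w\<close>; all others already lie in \<open>q @ ys\<close>.\<close>

lemma tight_list_snoc:
  assumes p: "tight_list F k (q @ ys)" and ys: "Suc (length ys) = k"
    and w: "insert w (set ys) \<in> F" "w \<notin> set (q @ ys)"
  shows "tight_list F k ((q @ ys) @ [w])"
  unfolding tight_list_def
proof (intro conjI allI impI)
  show "distinct ((q @ ys) @ [w])"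
    using p w by (auto simp: tight_list_def)
  fix j assume j: "j + k \<le> length ((q @ ys) @ [w])"
  show "(!) ((q @ ys) @ [w]) ` {j..<j + k} \<in> F"
  proof (cases "j = length q")
    case True
    have "(!) (q @ (ys @ [w])) ` {length q..<length q + length (ys @ [w])} = set (ys @ [w])"
      by (rule nth_image_append)
    then show ?thesis using True ys w(1) by simp
  next
    case False
    then have *: "j + k \<le> length (q @ ys)" using j ys by simp
    have "(!) ((q @ ys) @ [w]) ` {j..<j + k} = (!) (q @ ys) ` {j..<j + k}"
      using * by (intro image_cong) (auto simp: nth_append)
    then show ?thesis using p * by (auto simp: tight_list_def simp del: append_assoc)
  qed
qed

lemma tight_list_edge:
  assumes "finite e" "e \<in> F" "card e = k"
  obtains p where "tight_list F k p" "set p = e" "length p = k"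
proof -
  obtain p where p: "set p = e" "distinct p" "length p = card e"
    using assms(1) finite_distinct_list distinct_card by metis
  have "(!) p ` {0..<length p} = e"
    using nth_image[of "length p" p] p(1) by simp
  then have "tight_list F k p"
    using p assms by (auto simp: tight_list_def)
  with p assms show ?thesis using that by auto
qed

text \<open>Depth-first search. A state is a tight path \<open>p\<close>, the set \<open>Z\<close> of discarded
  vertices and the family \<open>T\<close> of the ends at which the search got stuck. Only vertices in
  \<open>Z\<close> or \<open>p\<close> count as visited, and the set of visited vertices never shrinks, so a stuck
  end keeps all its extensions inside it.\<close>

lemma tight_list_exists:
  fixes F :: "'a set set"
  assumes k: "k \<ge> 2"
    and F: "\<And>e. e \<in> F \<Longrightarrow> finite e \<and> card e = k"
    and avoid: "\<And>Z. finite Z \<Longrightarrow> card Z \<le> 2 * k * m \<Longrightarrow> \<exists>e\<in>F. e \<inter> Z = {}"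
    and expand: "\<And>T Q. T \<subseteq> shadow F \<Longrightarrow> card T = m \<Longrightarrow> pairwise disjnt T \<Longrightarrow> finite Q \<Longrightarrow>
        card Q \<le> n + 2 * k * m \<Longrightarrow> \<exists>t\<in>T. \<exists>w. insert w t \<in> F \<and> w \<notin> Q"
  shows "\<exists>p. tight_list F k p \<and> n \<le> length p"
proof (rule ccontr)
  assume "\<not> ?thesis"
  then have short: "length p < n" if "tight_list F k p" for p
    using that not_le by blast
  \<comment> \<open>\<open>j\<close> counts the stuck ends found so far. Each costs at most
    \<open>2 * k\<close> discarded vertices: its own \<open>k - 1\<close>, or the whole path if
    fewer than \<open>k\<close> vertices would remain.\<close>
  define st where "st j p Z T \<longleftrightarrow> tight_list F k p \<and> k \<le> length p \<and> finite Z \<and>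
    set p \<inter> Z = {} \<and> card Z \<le> 2 * k * j \<and> finite T \<and> card T = j \<and> T \<subseteq> shadow F \<and>
    pairwise disjnt T \<and> \<Union>T \<subseteq> Z \<and> (\<forall>t\<in>T. \<forall>w. insert w t \<in> F \<longrightarrow> w \<in> Z \<union> set p)" for j p Z T
  have ex: "\<exists>p Z T. st j p Z T" if "j \<le> m" for j
    using that
  proof (induction j)
    case 0
    obtain e where "e \<in> F" using avoid[of "{}"] by auto
    with F obtain p where "tight_list F k p" "length p = k"
      by (metis tight_list_edge)
    then have "st 0 p {} {}" by (auto simp: st_def)
    then show ?case by blast
  next
    case (Suc j)
    \<comment> \<open>A longest path among the states with \<open>j\<close> stuck ends plays the
      role of the running search. It cannot be extended, since an extension would give a longer
      state with the same \<open>Z\<close> and \<open>T\<close>; lengths are bounded by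
      \<open>short\<close>.\<close>
    define L where "L = {length p | p. \<exists>Z T. st j p Z T}"
    have "L \<subseteq> {..n}" using short by (force simp: st_def L_def)
    then have "finite L" by (rule finite_subset) simp
    moreover have "L \<noteq> {}" using Suc by (auto simp: L_def)
    ultimately have "Max L \<in> L" and max: "\<And>l. l \<in> L \<Longrightarrow> l \<le> Max L"
      by auto
    then obtain p Z T where s: "st j p Z T" and l: "length p = Max L" by (auto simp: L_def)
    define q ys where "q = take (length p - (k - 1)) p" and "ys = drop (length p - (k - 1)) p"
    have p: "p = q @ ys" and ys: "Suc (length ys) = k"
      using s k by (auto simp: q_def ys_def st_def)
    from s have s': "tight_list F k (q @ ys)" "k \<le> length (q @ ys)" "finite Z"
      "set (q @ ys) \<inter> Z = {}" "card Z \<le> 2 * k * j" "finite T" "card T = j" "T \<subseteq> shadow F"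
      "pairwise disjnt T" "\<Union>T \<subseteq> Z" "\<And>t w. t \<in> T \<Longrightarrow> insert w t \<in> F \<Longrightarrow> w \<in> Z \<union> set (q @ ys)"
      by (auto simp: st_def p)
    have stuck: "w \<in> Z \<union> set p" if w: "insert w (set ys) \<in> F" for w
    proof (rule ccontr)
      assume wn: "w \<notin> Z \<union> set p"
      have "tight_list F k (p @ [w])"
        using tight_list_snoc[OF s'(1) ys w] wn by (simp add: p)
      then have "st j (p @ [w]) Z T" using s wn by (auto simp: st_def)
      then have "length (p @ [w]) \<le> Max L" by (intro max) (unfold L_def, blast)
      with l show False by simp
    qed
    \<comment> \<open>The path has at least \<open>k\<close> vertices and its end \<open>ys\<close>
      only \<open>k - 1\<close>. So some vertex \<open>u\<close> precedes the end, and the last edge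
      of the path witnesses that \<open>set ys\<close> is in the shadow.\<close>
    have "q \<noteq> []" using s'(2) ys by auto
    define u where "u = last q"
    have qu: "q @ ys = butlast q @ (u # ys)" using \<open>q \<noteq> []\<close> by (simp add: u_def)
    have "(!) (butlast q @ (u # ys)) ` {length (butlast q)..<length (butlast q) + length (u # ys)} \<in> F"
      using s'(1,2) ys unfolding tight_list_def qu by (auto dest!: spec[of _ "length (butlast q)"])
    then have "insert u (set ys) \<in> F" unfolding nth_image_append by simp
    moreover have "u \<notin> set ys" using s'(1) unfolding qu by (auto simp: tight_list_def)
    ultimately have shad: "set ys \<in> shadow F" by (auto simp: shadow_def)
    have ysne: "set ys \<noteq> {}" using ys k by auto
    have dis: "disjnt (set ys) t" if "t \<in> T" for t
      using that s'(4,10) by (auto simp: disjnt_def)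
    have new: "set ys \<notin> T"
      using dis[of "set ys"] ysne by (auto simp: disjnt_def)
    have T': "card (insert (set ys) T) = Suc j" "insert (set ys) T \<subseteq> shadow F"
      "pairwise disjnt (insert (set ys) T)" "finite (insert (set ys) T)"
      using new s'(6,7,8,9) shad dis by (auto simp: pairwise_insert disjnt_sym)
    have ext: "\<forall>t\<in>insert (set ys) T. \<forall>w. insert w t \<in> F \<longrightarrow> w \<in> Z \<union> set q \<union> set ys"
      using s'(11) stuck unfolding p by auto
    show ?case
    \<comment> \<open>If \<open>q\<close> is long enough, the search backtracks by discarding the
      end alone. Otherwise the whole path is discarded and the search restarts at an edge that
      avoids everything visited so far.\<close>
    proof (cases "k \<le> length q")
      case True
      have "card (Z \<union> set ys) \<le> 2 * k * j + length ys"
        using card_Un_le[of Z "set ys"] s'(5) card_length[of ys] by linarith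
      then have "card (Z \<union> set ys) \<le> 2 * k * Suc j" using ys by simp
      moreover have "set q \<inter> (Z \<union> set ys) = {}"
        using s'(1,4) by (auto simp: tight_list_def)
      moreover have "\<Union>(insert (set ys) T) \<subseteq> Z \<union> set ys" "finite (Z \<union> set ys)"
        using s'(3,10) by auto
      moreover have "\<forall>t\<in>insert (set ys) T. \<forall>w. insert w t \<in> F \<longrightarrow> w \<in> (Z \<union> set ys) \<union> set q"
        using ext by blast
      ultimately have "st (Suc j) q (Z \<union> set ys) (insert (set ys) T)"
        unfolding st_def by (intro conjI True tight_list_appendD[OF s'(1)] T')
      then show ?thesis by blast
    next
      case False
      have "card (Z \<union> set p) \<le> 2 * k * j + length p"
        using card_Un_le[of Z "set p"] s'(5) card_length[of p] by linarith
      moreover have "length p \<le> 2 * k" using False ys by (simp add: p)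
      ultimately have c: "card (Z \<union> set p) \<le> 2 * k * Suc j" by simp
      also have "\<dots> \<le> 2 * k * m" using Suc.prems by (intro mult_le_mono2)
      finally obtain e where e: "e \<in> F" "e \<inter> (Z \<union> set p) = {}"
        using avoid[of "Z \<union> set p"] s'(3) by auto
      obtain p' where p': "tight_list F k p'" "set p' = e" "length p' = k"
        using F[OF e(1)] e(1) by (metis tight_list_edge)
      have "\<Union>(insert (set ys) T) \<subseteq> Z \<union> set p" "finite (Z \<union> set p)"
        "set p' \<inter> (Z \<union> set p) = {}" "k \<le> length p'"
        using s'(3,10) p' e by (auto simp: p)
      moreover have "\<forall>t\<in>insert (set ys) T. \<forall>w. insert w t \<in> F \<longrightarrow> w \<in> (Z \<union> set p) \<union> set p'"
        unfolding p set_append using ext by blast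
      ultimately have "st (Suc j) p' (Z \<union> set p) (insert (set ys) T)"
        unfolding st_def by (intro conjI p'(1) c T')
      then show ?thesis by blast
    qed
  qed
  \<comment> \<open>With \<open>m\<close> stuck ends, the visited set
    \<open>Z \<union> set p\<close> is small enough for \<open>expand\<close>, yet it contains all
    extensions of these ends.\<close>
  obtain p Z T where s: "st m p Z T" using ex by blast
  have "card (Z \<union> set p) \<le> n + 2 * k * m"
    using card_Un_le[of Z "set p"] card_length[of p] short[of p] s unfolding st_def by linarith
  with s expand[of T "Z \<union> set p"] show False
    by (auto simp: st_def)
qed

section \<open>Subfamilies with large minimum shadow degree\<close>

text \<open>\<open>G\<close> maximizes \<open>card G - a * card (shadow G)\<close>: deleting the fewer than \<open>a\<close> edges at a
  poor shadow set would increase this quantity.\<close>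

lemma exists_rich_subfamily:
  fixes F :: "'a set set" and a :: real
  assumes fin: "finite F" "\<And>e. e \<in> F \<Longrightarrow> finite e" and a: "a \<ge> 0"
  obtains G where "G \<subseteq> F" "real (card G) \<ge> real (card F) - a * real (card (shadow F))"
    "\<And>t. t \<in> shadow G \<Longrightarrow> real (card {w. w \<notin> t \<and> insert w t \<in> G}) \<ge> a"
proof -
  define \<mu> where "\<mu> G = real (card G) - a * real (card (shadow G))" for G :: "'a set set"
  have "finite (\<mu> ` Pow F)" "\<mu> ` Pow F \<noteq> {}" using fin by auto
  then have "Max (\<mu> ` Pow F) \<in> \<mu> ` Pow F" by (rule Max_in)
  then obtain G where G: "G \<subseteq> F" and mx: "\<mu> G = Max (\<mu> ` Pow F)" by auto
  have max: "\<mu> G' \<le> \<mu> G" if "G' \<subseteq> F" for G'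
    unfolding mx using that fin by (intro Max_ge) auto
  have finG: "finite G" using G fin(1) finite_subset by blast
  have shadG: "finite (shadow G)"
  proof (rule finite_subset)
    show "shadow G \<subseteq> Pow (\<Union>G)" by (auto simp: shadow_def)
    show "finite (Pow (\<Union>G))" using finG G fin(2) by auto
  qed
  show ?thesis
  proof
    show "G \<subseteq> F" by fact
    have "real (card F) - a * real (card (shadow F)) \<le> \<mu> G"
      using max[of F] by (simp add: \<mu>_def)
    also have "\<dots> \<le> real (card G)" using a by (simp add: \<mu>_def)
    finally show "real (card F) - a * real (card (shadow F)) \<le> real (card G)" .
  next
    fix t assume t: "t \<in> shadow G"
    define W where "W = {w. w \<notin> t \<and> insert w t \<in> G}"
    define R where "R = (\<lambda>w. insert w t) ` W"
    show "real (card {w. w \<notin> t \<and> insert w t \<in> G}) \<ge> a"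
    proof (rule ccontr)
      assume "\<not> ?thesis"
      then have lt: "real (card W) < a" by (simp add: W_def)
      have RG: "R \<subseteq> G" by (auto simp: R_def W_def)
      have "W \<subseteq> \<Union>G" by (auto simp: W_def)
      then have finW: "finite W" using finG G fin(2) by (meson finite_Union finite_subset subsetD)
      have "card R \<le> card W" unfolding R_def by (rule card_image_le[OF finW])
      then have "real (card G) \<le> real (card (G - R)) + real (card W)"
        using card_Diff_subset[of R G] RG finG finite_subset[OF RG finG] card_mono[OF finG RG]
        by simp
      moreover have "shadow (G - R) \<subseteq> shadow G - {t}"
        by (auto simp: shadow_def R_def W_def)
      then have "card (shadow (G - R)) \<le> card (shadow G) - 1"
        using card_mono[of "shadow G - {t}"] shadG t by (simp add: card_Diff_singleton)
      then have "real (card (shadow (G - R))) \<le> real (card (shadow G)) - 1"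
        using t shadG by (metis One_nat_def Suc_leI card_gt_0_iff empty_iff of_nat_1 of_nat_diff of_nat_le_iff)
      then have "a * real (card (shadow (G - R))) \<le> a * (real (card (shadow G)) - 1)"
        using a by (intro mult_left_mono)
      moreover have "\<mu> (G - R) \<le> \<mu> G" using G by (intro max) auto
      ultimately show False using lt by (simp add: \<mu>_def algebra_simps)
    qed
  qed
qed

section \<open>Random subsets\<close>

text \<open>The probability of \<open>A\<close> when every element of \<open>I\<close> is chosen independently with
  probability \<open>p\<close>.\<close>

definition wt :: "real \<Rightarrow> 'a set \<Rightarrow> 'a set \<Rightarrow> real" where
  "wt p I A = p ^ card A * (1 - p) ^ card (I - A)"

lemma wt_nonneg: "0 \<le> p \<Longrightarrow> p \<le> 1 \<Longrightarrow> wt p I A \<ge> 0"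
  by (simp add: wt_def)

lemma prod_one_plus:
  fixes f :: "'a \<Rightarrow> 'b :: comm_semiring_1"
  assumes "finite A"
  shows "(\<Prod>x\<in>A. 1 + f x) = (\<Sum>S\<in>Pow A. prod f S)"
  using prod_add[OF assms, of f "\<lambda>_. 1"] by (simp add: add.commute)

text \<open>Expand the product over \<open>I\<close> of the factors \<open>p + 0\<close> on
  \<open>B\<close> and \<open>p + (1 - p)\<close> elsewhere: there is one term for each subset, and
  it vanishes unless the subset contains \<open>B\<close>. For \<open>B = {}\<close> this says that
  the weights add up to \<open>1\<close>.\<close>

lemma sum_wt_superset:
  assumes I: "finite I" and B: "B \<subseteq> I"
  shows "(\<Sum>A\<in>Pow I. if B \<subseteq> A then wt p I A else 0) = p ^ card B"
proof -
  have "p ^ card B = (\<Prod>x\<in>I. if x \<in> B then p else 1)"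
    using B I by (simp add: prod.If_cases Int_absorb1)
  also have "\<dots> = (\<Prod>x\<in>I. p + (if x \<in> B then 0 else 1 - p))"
    by (intro prod.cong) auto
  also have "\<dots> = (\<Sum>A\<in>Pow I. (\<Prod>x\<in>A. p) * (\<Prod>x\<in>I - A. if x \<in> B then 0 else 1 - p))"
    by (rule prod_add[OF I])
  also have "\<dots> = (\<Sum>A\<in>Pow I. if B \<subseteq> A then wt p I A else 0)"
  proof (intro sum.cong refl)
    fix A assume A: "A \<in> Pow I"
    show "(\<Prod>x\<in>A. p) * (\<Prod>x\<in>I - A. if x \<in> B then 0 else 1 - p) = (if B \<subseteq> A then wt p I A else 0)"
    proof (cases "B \<subseteq> A")
      case True
      then have "(\<Prod>x\<in>I - A. if x \<in> B then 0 else 1 - p) = (\<Prod>x\<in>I - A. 1 - p)"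
        by (intro prod.cong) auto
      with True show ?thesis by (simp add: wt_def)
    next
      case False
      then obtain x where "x \<in> B" "x \<in> I - A" using B by auto
      then have "(\<Prod>x\<in>I - A. if x \<in> B then 0 else 1 - p) = 0"
        using I by (intro prod_zero) auto
      with False show ?thesis by simp
    qed
  qed
  finally show ?thesis by simp
qed

text \<open>This is the generating function of a binomial variable: the disjoint sets
  \<open>B l\<close> are included independently, each with probability \<open>p ^ b\<close>. The
  proof expands the power over subfamilies \<open>S\<close> of \<open>L\<close>; by disjointness all
  sets of \<open>S\<close> are included with probability \<open>p ^ (b * card S)\<close>, and the
  sum factors again.\<close>

lemma wt_generating_function:
  fixes B :: "'l \<Rightarrow> 'a set" and c :: real
  assumes I: "finite I" and L: "finite L"
    and B: "\<And>l. l \<in> L \<Longrightarrow> B l \<subseteq> I" "\<And>l. l \<in> L \<Longrightarrow> card (B l) = b"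
    and disj: "disjoint_family_on B L"
  shows "(\<Sum>A\<in>Pow I. wt p I A * (1 + c) ^ card {l \<in> L. B l \<subseteq> A}) = (1 + c * p ^ b) ^ card L"
proof -
  have 1: "(1 + c) ^ card {l \<in> L. B l \<subseteq> A} =
      (\<Sum>S\<in>Pow L. c ^ card S * (if \<Union>(B ` S) \<subseteq> A then 1 else 0))" for A
  proof -
    have "(1 + c) ^ card {l \<in> L. B l \<subseteq> A} = (\<Prod>l\<in>{l \<in> L. B l \<subseteq> A}. 1 + c)"
      by simp
    also have "\<dots> = (\<Prod>l\<in>L. 1 + (if B l \<subseteq> A then c else 0))"
      using L by (intro prod.mono_neutral_cong_left) auto
    also have "\<dots> = (\<Sum>S\<in>Pow L. \<Prod>l\<in>S. if B l \<subseteq> A then c else 0)"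
      using L by (rule prod_one_plus)
    also have "\<dots> = (\<Sum>S\<in>Pow L. c ^ card S * (if \<Union>(B ` S) \<subseteq> A then 1 else 0))"
    proof (intro sum.cong refl)
      fix S assume "S \<in> Pow L"
      then have S: "finite S" using L finite_subset by auto
      show "(\<Prod>l\<in>S. if B l \<subseteq> A then c else 0) = c ^ card S * (if \<Union>(B ` S) \<subseteq> A then 1 else 0)"
      proof (cases "\<Union>(B ` S) \<subseteq> A")
        case True
        then have "(\<Prod>l\<in>S. if B l \<subseteq> A then c else 0) = (\<Prod>l\<in>S. c)"
          by (intro prod.cong) auto
        with True show ?thesis by simp
      next
        case False
        then obtain l where "l \<in> S" "\<not> B l \<subseteq> A" by auto
        with S have "(\<Prod>l\<in>S. if B l \<subseteq> A then c else 0) = 0"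
          by (intro prod_zero) auto
        with False show ?thesis by simp
      qed
    qed
    finally show ?thesis .
  qed
  have "(\<Sum>A\<in>Pow I. wt p I A * (1 + c) ^ card {l \<in> L. B l \<subseteq> A}) =
      (\<Sum>A\<in>Pow I. \<Sum>S\<in>Pow L. wt p I A * (c ^ card S * (if \<Union>(B ` S) \<subseteq> A then 1 else 0)))"
    by (simp add: 1 sum_distrib_left)
  also have "\<dots> = (\<Sum>S\<in>Pow L. \<Sum>A\<in>Pow I. wt p I A * (c ^ card S * (if \<Union>(B ` S) \<subseteq> A then 1 else 0)))"
    by (rule sum.swap)
  also have "\<dots> = (\<Sum>S\<in>Pow L. c ^ card S * (\<Sum>A\<in>Pow I. if \<Union>(B ` S) \<subseteq> A then wt p I A else 0))"
    by (simp add: sum_distrib_left if_distrib mult_ac cong: if_cong)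
  also have "\<dots> = (\<Sum>S\<in>Pow L. c ^ card S * p ^ (b * card S))"
  proof (intro sum.cong refl)
    fix S assume "S \<in> Pow L"
    then have S: "S \<subseteq> L" "finite S" using L finite_subset by auto
    have "B l \<inter> B l' = {}" if "l \<in> S" "l' \<in> S" "l \<noteq> l'" for l l'
      using that S(1) disj by (meson disjoint_family_onD subsetD)
    moreover have "finite (B l)" if "l \<in> S" for l
      using that S(1) B(1) I finite_subset by blast
    ultimately have "card (\<Union>(B ` S)) = (\<Sum>l\<in>S. card (B l))"
      using S(2) by (intro card_UN_disjoint) simp_all
    also have "\<dots> = b * card S" using B(2) S(1) by (subst sum.cong[of S S _ "\<lambda>_. b"]) auto
    finally have "card (\<Union>(B ` S)) = b * card S" .
    moreover have "\<Union>(B ` S) \<subseteq> I" using B(1) S(1) by auto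
    ultimately show "c ^ card S * (\<Sum>A\<in>Pow I. if \<Union>(B ` S) \<subseteq> A then wt p I A else 0) =
        c ^ card S * p ^ (b * card S)"
      using sum_wt_superset[OF I] by metis
  qed
  also have "\<dots> = (\<Sum>S\<in>Pow L. \<Prod>l\<in>S. c * p ^ b)"
    by (simp add: power_mult power_mult_distrib)
  also have "\<dots> = (\<Prod>l\<in>L. 1 + c * p ^ b)"
    by (rule prod_one_plus[OF L, symmetric])
  finally show ?thesis by simp
qed

definition prb :: "real \<Rightarrow> 'a set \<Rightarrow> ('a set \<Rightarrow> bool) \<Rightarrow> real" where
  "prb p I P = (\<Sum>A\<in>Pow I. if P A then wt p I A else 0)"

text \<open>This is Markov's inequality for a test function \<open>f\<close> that dominates the
  indicator of the event.\<close>

lemma prb_le: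
  assumes "finite I" "0 \<le> p" "p \<le> 1" and "\<And>A. f A \<ge> 0" and "\<And>A. A \<subseteq> I \<Longrightarrow> P A \<Longrightarrow> f A \<ge> (1::real)"
  shows "prb p I P \<le> (\<Sum>A\<in>Pow I. wt p I A * f A)"
  unfolding prb_def
proof (intro sum_mono)
  fix A assume "A \<in> Pow I"
  then show "(if P A then wt p I A else 0) \<le> wt p I A * f A"
    using assms(4)[of A] assms(5)[of A] mult_left_mono[of 1 "f A" "wt p I A"]
      wt_nonneg[OF assms(2,3), of I A] by auto
qed

section \<open>Tail bounds for the number of included sets\<close>

text \<open>Exponential moments with base \<open>2\<close>, respectively \<open>1/2\<close> below.\<close>

lemma prb_many:
  fixes B :: "'l \<Rightarrow> 'a set"
  assumes I: "finite I" and L: "finite L" and p: "0 \<le> p" "p \<le> 1"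
    and B: "\<And>l. l \<in> L \<Longrightarrow> B l \<subseteq> I" "\<And>l. l \<in> L \<Longrightarrow> card (B l) = b"
    and disj: "disjoint_family_on B L"
    and a: "a \<ge> 0"
  shows "prb p I (\<lambda>A. real (card {l \<in> L. B l \<subseteq> A}) \<ge> a) \<le> exp (real (card L) * p ^ b - a / 2)"
proof -
  \<comment> \<open>Since \<open>exp (1 / 2) \<le> 2\<close>, the moment with base \<open>2\<close>
    gains a factor \<open>exp (a / 2)\<close> on the event.\<close>
  have exp_half: "exp (a / 2) \<le> (2::real) ^ m" if "a \<le> real m" for m
  proof -
    have "exp (a / 2) \<le> exp (real m * (1 / 2))" using that by simp
    also have "\<dots> = exp (1 / 2) ^ m" by (rule exp_of_nat_mult)
    also have "\<dots> \<le> 2 ^ m" using exp_half_le2 by (intro power_mono) auto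
    finally show ?thesis .
  qed
  have "prb p I (\<lambda>A. real (card {l \<in> L. B l \<subseteq> A}) \<ge> a) \<le>
      (\<Sum>A\<in>Pow I. wt p I A * (exp (- (a / 2)) * (1 + 1) ^ card {l \<in> L. B l \<subseteq> A}))"
    using exp_half by (intro prb_le[OF I p]) (auto simp: exp_minus field_simps)
  also have "\<dots> = exp (- (a / 2)) * (\<Sum>A\<in>Pow I. wt p I A * (1 + 1) ^ card {l \<in> L. B l \<subseteq> A})"
    by (simp only: sum_distrib_left mult_ac)
  also have "\<dots> = exp (- (a / 2)) * (1 + p ^ b) ^ card L"
    using wt_generating_function[OF I L B disj, of p 1] by simp
  also have "\<dots> \<le> exp (- (a / 2)) * exp (p ^ b) ^ card L"
    using p by (intro mult_left_mono power_mono) (auto simp: exp_ge_add_one_self)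
  also have "\<dots> = exp (real (card L) * p ^ b - a / 2)"
    by (simp add: exp_of_nat_mult[symmetric] exp_add[symmetric])
  finally show ?thesis .
qed

lemma prb_few:
  fixes B :: "'l \<Rightarrow> 'a set"
  assumes I: "finite I" and L: "finite L" and p: "0 \<le> p" "p \<le> 1"
    and B: "\<And>l. l \<in> L \<Longrightarrow> B l \<subseteq> I" "\<And>l. l \<in> L \<Longrightarrow> card (B l) = b"
    and disj: "disjoint_family_on B L"
    and a: "a \<ge> 0"
  shows "prb p I (\<lambda>A. real (card {l \<in> L. B l \<subseteq> A}) \<le> a) \<le> exp (a - real (card L) * p ^ b / 2)"
proof -
  have two: "(2::real) ^ m \<le> exp a" if "real m \<le> a" for m
  proof -
    have "(2::real) ^ m \<le> exp 1 ^ m"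
      using exp_ge_add_one_self[of "1::real"] by (intro power_mono) auto
    also have "\<dots> = exp (real m)" using exp_of_nat_mult[of m "1::real"] by simp
    also have "\<dots> \<le> exp a" using that by simp
    finally show ?thesis .
  qed
  have pb: "p ^ b \<le> 1" using p by (simp add: power_le_one)
  have "prb p I (\<lambda>A. real (card {l \<in> L. B l \<subseteq> A}) \<le> a) \<le>
      (\<Sum>A\<in>Pow I. wt p I A * (exp a * (1 + - (1/2)) ^ card {l \<in> L. B l \<subseteq> A}))"
    using two by (intro prb_le[OF I p]) (auto simp: field_simps power_divide)
  also have "\<dots> = exp a * (\<Sum>A\<in>Pow I. wt p I A * (1 + - (1/2)) ^ card {l \<in> L. B l \<subseteq> A})"
    by (simp only: sum_distrib_left mult_ac)
  also have "\<dots> = exp a * (1 + - (1/2) * p ^ b) ^ card L"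
    using wt_generating_function[OF I L B disj, of p "-(1/2)"] by simp
  also have "\<dots> \<le> exp a * exp (- (1/2) * p ^ b) ^ card L"
    using pb p exp_ge_add_one_self[of "- (1/2) * p ^ b"] by (intro mult_left_mono power_mono) auto
  also have "\<dots> = exp (a - real (card L) * p ^ b / 2)"
    by (simp add: exp_of_nat_mult[symmetric] exp_add[symmetric])
  finally show ?thesis .
qed

lemma prb_disj:
  assumes "0 \<le> p" "p \<le> 1"
  shows "prb p I (\<lambda>A. P A \<or> Q A) \<le> prb p I P + prb p I Q"
  unfolding prb_def sum.distrib[symmetric]
  by (intro sum_mono) (auto simp: assms wt_nonneg)

lemma prb_Bex:
  assumes "0 \<le> p" "p \<le> 1" and X: "finite X"
  shows "prb p I (\<lambda>A. \<exists>x\<in>X. P x A) \<le> (\<Sum>x\<in>X. prb p I (P x))"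
  using X
proof (induction X rule: finite_induct)
  case empty
  show ?case by (simp add: prb_def)
next
  case (insert x X)
  have "prb p I (\<lambda>A. \<exists>x\<in>insert x X. P x A) \<le> prb p I (P x) + prb p I (\<lambda>A. \<exists>x\<in>X. P x A)"
    using prb_disj[OF assms(1,2), of I "P x"] by simp
  with insert show ?case by simp
qed

text \<open>The total weight is \<open>1\<close>, so an event of smaller probability fails for some
  subset. This turns the union bound into existence.\<close>

lemma prb_less_1E:
  assumes "finite I" "prb p I P < 1"
  obtains A where "A \<subseteq> I" "\<not> P A"
proof (rule ccontr)
  assume "\<not> thesis"
  with that have "P A" if "A \<subseteq> I" for A using \<open>A \<subseteq> I\<close> by blast
  then have "prb p I P = (\<Sum>A\<in>Pow I. wt p I A)"
    unfolding prb_def by (intro sum.cong) auto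
  also have "\<dots> = 1" using sum_wt_superset[OF assms(1), of "{}" p] by simp
  finally show False using assms(2) by simp
qed

section \<open>Random cyclic digraphs\<close>

text \<open>The vertex \<open>v\<close> belongs to the class \<open>v mod k\<close>.\<close>

definition part :: "nat \<Rightarrow> nat \<Rightarrow> nat \<Rightarrow> nat set" where
  "part k N i = {v. v < N * k \<and> v mod k = i}"

definition arcs :: "nat \<Rightarrow> nat \<Rightarrow> (nat \<times> nat) set" where
  "arcs k N = {(u, v). u < N * k \<and> v < N * k \<and> v mod k = Suc u mod k}"

definition mid :: "('a \<times> 'a) set \<Rightarrow> 'a \<Rightarrow> 'a \<Rightarrow> 'a set" where
  "mid A u v = {w. (u, w) \<in> A \<and> (w, v) \<in> A}"

lemma finite_part: "finite (part k N i)"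
  by (simp add: part_def)

lemma finite_arcs: "finite (arcs k N)"
  by (rule finite_subset[of _ "{..<N * k} \<times> {..<N * k}"]) (auto simp: arcs_def)

lemma card_part:
  assumes "i < k"
  shows "card (part k N i) = N"
proof -
  have "part k N i = (\<lambda>x. x * k + i) ` {..<N}"
  proof (intro set_eqI iffI)
    fix v assume "v \<in> part k N i"
    then have v: "v < N * k" "v mod k = i" by (auto simp: part_def)
    then have "v = v div k * k + i" by (metis div_mult_mod_eq)
    moreover have "v div k < N" using v(1) by (simp add: less_mult_imp_div_less)
    ultimately show "v \<in> (\<lambda>x. x * k + i) ` {..<N}" by blast
  next
    fix v assume "v \<in> (\<lambda>x. x * k + i) ` {..<N}"
    then obtain x where x: "x < N" "v = x * k + i" by auto
    have "x * k + i < Suc x * k" using assms by simp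
    also have "\<dots> \<le> N * k" using x(1) by (intro mult_le_mono1) simp
    finally show "v \<in> part k N i" using x(2) assms by (simp add: part_def)
  qed
  moreover have "inj_on (\<lambda>x. x * k + i) {..<N}" using assms by (auto simp: inj_on_def)
  ultimately show ?thesis by (simp add: card_image)
qed

lemma Suc_mod_neq:
  assumes "k \<ge> 2"
  shows "Suc u mod k \<noteq> u mod k"
  using assms by (auto simp: mod_Suc)

text \<open>These are the pairs from the two classes next to class \<open>i\<close>. The condition
  \<open>Suc u mod k = i\<close> places \<open>u\<close> in the preceding class without subtraction
  modulo \<open>k\<close>.\<close>

definition across :: "nat \<Rightarrow> nat \<Rightarrow> nat \<Rightarrow> (nat \<times> nat) set" where
  "across k N i = {(u, v). u < N * k \<and> v < N * k \<and> Suc u mod k = i \<and> v mod k = Suc i mod k}"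

text \<open>These two arcs are exactly what puts \<open>w\<close> into
  \<open>mid A u v\<close>.\<close>

definition hinge :: "('a \<times> 'a) \<times> 'a \<Rightarrow> ('a \<times> 'a) set" where
  "hinge = (\<lambda>((u, v), w). {(u, w), (w, v)})"

text \<open>The tail bounds need disjoint sets of arcs. Hinges with the same middle vertex differ in
  both ends because \<open>S\<close> is injective in each coordinate. An arc into \<open>Q\<close>
  is never an arc out of \<open>Q\<close>, because consecutive classes differ for
  \<open>k \<ge> 2\<close>.\<close>

lemma hinge:
  assumes k: "k \<ge> 2" and S: "S \<subseteq> across k N i" "inj_on fst S" "inj_on snd S"
    and Q: "Q \<subseteq> part k N i"
  shows "\<And>l. l \<in> S \<times> Q \<Longrightarrow> hinge l \<subseteq> arcs k N"
    "\<And>l. l \<in> S \<times> Q \<Longrightarrow> card (hinge l) = 2"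
    "disjoint_family_on hinge (S \<times> Q)"
proof -
  have sep: "u \<noteq> w" if "(u, v) \<in> S" "w \<in> Q" for u v w
    using that S(1) Q Suc_mod_neq[OF k, of u] by (auto simp: across_def part_def)
  show "hinge l \<subseteq> arcs k N" if "l \<in> S \<times> Q" for l
  proof -
    obtain u v w where l: "l = ((u, v), w)" "(u, v) \<in> S" "w \<in> Q" using \<open>l \<in> S \<times> Q\<close> by auto
    then have "(u, v) \<in> across k N i" "w \<in> part k N i" using S(1) Q by auto
    then show ?thesis using l(1) by (auto simp: hinge_def arcs_def across_def part_def mod_Suc_eq)
  qed
  show "card (hinge l) = 2" if "l \<in> S \<times> Q" for l
    using that sep by (fastforce simp: hinge_def card_2_iff)
  show "disjoint_family_on hinge (S \<times> Q)"
  unfolding disjoint_family_on_def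
  proof (intro ballI impI)
    fix l l' assume l: "l \<in> S \<times> Q" "l' \<in> S \<times> Q" "l \<noteq> l'"
    obtain u v w u' v' w' where [simp]: "l = ((u, v), w)" "l' = ((u', v'), w')"
      by (metis surj_pair)
    have "u \<noteq> u' \<and> v \<noteq> v'" if "w = w'"
    proof -
      have "(u, v) \<in> S" "(u', v') \<in> S" "(u, v) \<noteq> (u', v')" using that l by simp_all
      then show ?thesis using S(2,3) unfolding inj_on_def by (metis fst_conv snd_conv)
    qed
    moreover have "u \<noteq> w'" "u' \<noteq> w"
      using l sep by auto
    ultimately show "hinge l \<inter> hinge l' = {}"
      by (auto simp: hinge_def)
  qed
qed

lemma card_hinge_subset:
  assumes "finite S" "finite Q"
  shows "card {l \<in> S \<times> Q. hinge l \<subseteq> A} = (\<Sum>(u, v)\<in>S. card (mid A u v \<inter> Q))"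
proof -
  have "{l \<in> S \<times> Q. hinge l \<subseteq> A} = (SIGMA uv:S. mid A (fst uv) (snd uv) \<inter> Q)"
    by (auto simp: hinge_def mid_def)
  then show ?thesis
    using assms by (simp add: case_prod_unfold)
qed

text \<open>\<open>D\<close> and \<open>d\<close> stand for the expected out-degree and codegree;
  the factors \<open>4\<close> are the slack of the tail bounds. The last clause is the expansion
  that feeds the search: a small \<open>Q\<close> cannot hold \<open>\<epsilon> * d\<close> common
  neighbours for each of \<open>m\<close> pairs with distinct ends.\<close>

definition quasirandom :: "nat \<Rightarrow> nat \<Rightarrow> nat \<Rightarrow> real \<Rightarrow> real \<Rightarrow> real \<Rightarrow> (nat \<times> nat) set \<Rightarrow> bool" where
  "quasirandom k N m \<epsilon> D d A \<longleftrightarrow> A \<subseteq> arcs k N \<and>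
     (\<forall>u<N * k. D / 4 \<le> real (card (A `` {u})) \<and> real (card (A `` {u})) \<le> 4 * D) \<and>
     (\<forall>u<N * k. \<forall>v<N * k. v mod k = (u + 2) mod k \<longrightarrow>
        d / 4 \<le> real (card (mid A u v)) \<and> real (card (mid A u v)) \<le> 4 * d) \<and>
     (\<forall>i<k. \<forall>S Q. S \<subseteq> across k N i \<and> inj_on fst S \<and> inj_on snd S \<and> card S = m \<and>
        Q \<subseteq> part k N i \<and> real (card Q) \<le> \<epsilon> * real N / 4 \<longrightarrow>
        (\<exists>(u, v)\<in>S. real (card (mid A u v \<inter> Q)) < \<epsilon> * d))"

section \<open>Existence of quasirandom digraphs by a union bound\<close>

lemma choose_le_power: "n choose m \<le> n ^ m"
  by (cases "m \<le> n") (auto simp: binomial_le_pow binomial_eq_0)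

text \<open>There are at most \<open>M ^ (2 * m) * 2 ^ M\<close> pairs \<open>(S, Q)\<close>, each
  bad with probability at most \<open>exp (- 4 * m * ln M)\<close>. The hypothesis
  \<open>M \<le> m * ln M\<close> lets the latter absorb the factor \<open>2 ^ M\<close>.\<close>

lemma exists_quasirandom:
  fixes k N m :: nat and \<epsilon> d D :: real
  defines "M \<equiv> N * k"
  assumes k: "k \<ge> 2" and M: "M \<ge> 3" and m: "real M \<le> real m * ln M"
    and \<epsilon>: "0 < \<epsilon>" "\<epsilon> \<le> 1" and d: "d = 16 / \<epsilon> * ln M" and dN: "d \<le> N"
    and D: "D = sqrt (N * d)"
  shows "\<exists>A. quasirandom k N m \<epsilon> D d A"
proof -
  \<comment> \<open>This makes the expected codegree \<open>N * p\<^sup>2\<close> equal to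
    \<open>d\<close> and the expected out-degree \<open>N * p\<close> equal to \<open>D\<close>;
    \<open>d \<le> N\<close> gives \<open>p \<le> 1\<close>.\<close>
  define p where "p = sqrt (d / N)"
  let ?I = "arcs k N"
  have N: "N > 0" using M by (auto simp: M_def intro: Nat.gr0I)
  have lnM: "ln (real M) \<ge> 1"
  proof -
    have "exp 1 \<le> (3::real)" by (rule exp_le)
    then show ?thesis using M by (subst ln_ge_iff) auto
  qed
  have d0: "d \<ge> 0" using d \<epsilon> lnM by auto
  have p: "0 \<le> p" "p \<le> 1" using d0 dN N by (auto simp: p_def)
  have p2: "N * p\<^sup>2 = d" using N d0 by (simp add: p_def)
  have p1: "N * p = D"
    using N by (simp add: p_def D real_sqrt_divide real_sqrt_mult)
      (metis mult.commute of_nat_0_le_iff real_div_sqrt times_divide_eq_right)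
  have "d = sqrt (d * d)" using d0 by simp
  also have "\<dots> \<le> D" unfolding D using d0 dN by (intro real_sqrt_le_mono mult_right_mono)
  finally have dD: "d \<le> D" .
  \<comment> \<open>\<open>q\<close> bounds each tail of one degree or codegree, for degrees because
    \<open>d \<le> D\<close>. The factor \<open>16\<close> in \<open>d\<close> brings it down to
    \<open>M ^ -4\<close>, enough against at most \<open>M\<^sup>2\<close> pairs of
    vertices.\<close>
  define q where "q = exp (- d / 4)"
  have qM: "q \<le> 1 / real M ^ 4"
  proof -
    have "4 * ln M \<le> d / 4" using \<epsilon> lnM unfolding d by (simp add: field_simps)
    then have "q \<le> exp (- (4 * ln M))" by (simp add: q_def)
    also have "\<dots> = 1 / real M ^ 4"
      using M exp_of_nat_mult[of 4 "ln (real M)"] by (simp add: exp_minus field_simps)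
    finally show ?thesis .
  qed
  define Bout :: "nat \<Rightarrow> nat \<Rightarrow> (nat \<times> nat) set" where "Bout u = (\<lambda>w. {(u, w)})" for u
  define P where "P u = part k N (Suc u mod k)" for u
  define bad1 where "bad1 u A \<longleftrightarrow> 4 * D \<le> card {w \<in> P u. Bout u w \<subseteq> A} \<or> card {w \<in> P u. Bout u w \<subseteq> A} \<le> D / 4"
    for u A
  define bad2 where "bad2 uv A \<longleftrightarrow> 4 * d \<le> card {l \<in> {uv} \<times> P (fst uv). hinge l \<subseteq> A} \<or>
    card {l \<in> {uv} \<times> P (fst uv). hinge l \<subseteq> A} \<le> d / 4" for uv A
  define bad3 where "bad3 SQ A \<longleftrightarrow> real m * \<epsilon> * d \<le> card {l \<in> fst SQ \<times> snd SQ. hinge l \<subseteq> A}"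
    for SQ :: "(nat \<times> nat) set \<times> nat set" and A
  let ?X2 = "{(u, v). u < M \<and> v < M \<and> v mod k = (u + 2) mod k}"
  let ?X3 = "{(S, Q). \<exists>i<k. S \<subseteq> across k N i \<and> inj_on fst S \<and> inj_on snd S \<and> card S = m \<and>
        Q \<subseteq> part k N i \<and> card Q \<le> \<epsilon> * N / 4}"
  have card_P: "card (P u) = N" for u using k by (simp add: P_def card_part)
  have finP: "finite (P u)" for u by (simp add: P_def finite_part)
  have b1: "prb p ?I (bad1 u) \<le> 2 * q" if u: "u < M" for u
  proof -
    have B: "\<And>w. w \<in> P u \<Longrightarrow> Bout u w \<subseteq> ?I" "\<And>w. w \<in> P u \<Longrightarrow> card (Bout u w) = 1"
      "disjoint_family_on (Bout u) (P u)"
      using u by (auto simp: Bout_def P_def part_def arcs_def M_def disjoint_family_on_def)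
    have "prb p ?I (bad1 u) \<le> exp (N * p - 4 * D / 2) + exp (D / 4 - N * p / 2)"
      using prb_many[OF finite_arcs finP p B, of "4 * D"] prb_few[OF finite_arcs finP p B, of "D / 4"]
        d0 dD unfolding bad1_def card_P
      by (intro order.trans[OF prb_disj[OF p]]) simp
    also have "\<dots> \<le> q + q"
      using d0 dD unfolding q_def p1 by (intro add_mono) auto
    finally show ?thesis by simp
  qed
  have b2: "prb p ?I (bad2 uv) \<le> 2 * q" if uv: "uv \<in> ?X2" for uv
  proof -
    let ?i = "Suc (fst uv) mod k"
    have "{uv} \<subseteq> across k N ?i" using uv by (auto simp: across_def M_def mod_Suc_eq)
    then have B: "\<And>l. l \<in> {uv} \<times> P (fst uv) \<Longrightarrow> hinge l \<subseteq> ?I"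
      "\<And>l. l \<in> {uv} \<times> P (fst uv) \<Longrightarrow> card (hinge l) = 2"
      "disjoint_family_on hinge ({uv} \<times> P (fst uv))"
      using hinge[OF k, of "{uv}" N ?i "P (fst uv)"] by (auto simp: P_def)
    have fin: "finite ({uv} \<times> P (fst uv))" using finP by auto
    have "prb p ?I (bad2 uv) \<le> exp (N * p\<^sup>2 - 4 * d / 2) + exp (d / 4 - N * p\<^sup>2 / 2)"
      using prb_many[OF finite_arcs fin p B, of "4 * d"] prb_few[OF finite_arcs fin p B, of "d / 4"]
        d0 unfolding bad2_def card_cartesian_product card_P
      by (intro order.trans[OF prb_disj[OF p]]) simp
    also have "\<dots> \<le> q + q"
      using d0 unfolding q_def p2 by (intro add_mono) auto
    finally show ?thesis by simp
  qed
  \<comment> \<open>The expected number of hinges is at most \<open>m * \<epsilon> * d / 4\<close>,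
    a quarter of the threshold. The exponent is then at most
    \<open>- m * \<epsilon> * d / 4\<close>, and \<open>\<epsilon> * d = 16 * ln M\<close>.\<close>
  have b3: "prb p ?I (bad3 SQ) \<le> exp (- (4 * m * ln M))" if SQ: "SQ \<in> ?X3" for SQ
  proof -
    obtain S Q i where SQ': "SQ = (S, Q)" "S \<subseteq> across k N i" "inj_on fst S" "inj_on snd S" "card S = m"
      "Q \<subseteq> part k N i" "card Q \<le> \<epsilon> * N / 4" using SQ by auto
    have fin: "finite (S \<times> Q)"
    proof (rule finite_subset)
      show "S \<times> Q \<subseteq> ({..<M} \<times> {..<M}) \<times> {..<M}"
        using SQ' by (fastforce simp: across_def part_def M_def)
    qed simp
    have "prb p ?I (bad3 SQ) \<le> exp (real (m * card Q) * p\<^sup>2 - real m * \<epsilon> * d / 2)"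
      using prb_many[OF finite_arcs fin p hinge[OF k SQ'(2,3,4,6)], of "real m * \<epsilon> * d"] d0 \<epsilon>
      unfolding bad3_def SQ'(1) card_cartesian_product SQ'(5) by simp
    also have "\<dots> \<le> exp (- (4 * m * ln M))"
    proof -
      have "real (m * card Q) * p\<^sup>2 \<le> real m * (\<epsilon> * N / 4) * p\<^sup>2"
        unfolding of_nat_mult using SQ'(7) by (intro mult_right_mono mult_left_mono) auto
      also have "\<dots> = real m * \<epsilon> / 4 * (N * p\<^sup>2)" by simp
      also have "\<dots> = real m * \<epsilon> / 4 * d" by (simp only: p2)
      finally have "real (m * card Q) * p\<^sup>2 - real m * \<epsilon> * d / 2 \<le> - (real m * (\<epsilon> * d) / 4)"
        by simp
      also have "\<epsilon> * d = 16 * ln M" using \<epsilon> by (simp add: d)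
      finally show ?thesis by simp
    qed
    finally show ?thesis .
  qed
  have X2: "?X2 \<subseteq> {..<M} \<times> {..<M}" by auto
  have X3: "?X3 \<subseteq> {S. S \<subseteq> {..<M} \<times> {..<M} \<and> card S = m} \<times> Pow {..<M}"
    by (fastforce simp: across_def part_def M_def)
  have finX3': "finite ({S. S \<subseteq> {..<M} \<times> {..<M} \<and> card S = m} \<times> Pow {..<M})"
  proof (rule finite_cartesian_product)
    show "finite {S. S \<subseteq> {..<M} \<times> {..<M} \<and> card S = m}"
      by (rule finite_subset[of _ "Pow ({..<M} \<times> {..<M})"]) (blast, simp)
  qed simp
  have finX: "finite ?X2" "finite ?X3"
    using finite_subset[OF X2] finite_subset[OF X3 finX3'] by auto
  have "prb p ?I (\<lambda>A. (\<exists>u\<in>{..<M}. bad1 u A) \<or> (\<exists>uv\<in>?X2. bad2 uv A) \<or> (\<exists>SQ\<in>?X3. bad3 SQ A)) \<le>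
      (\<Sum>u<M. prb p ?I (bad1 u)) + ((\<Sum>uv\<in>?X2. prb p ?I (bad2 uv)) + (\<Sum>SQ\<in>?X3. prb p ?I (bad3 SQ)))"
    by (intro order.trans[OF prb_disj[OF p]] add_mono prb_Bex[OF p] finX) auto
  also have "\<dots> \<le> real M * (2 * q) + (real M ^ 2 * (2 * q) + (M\<^sup>2) ^ m * 2 ^ M * exp (- (4 * m * ln M)))"
  proof (intro add_mono)
    show "(\<Sum>u<M. prb p ?I (bad1 u)) \<le> real M * (2 * q)"
      using sum_bounded_above[of "{..<M}" "\<lambda>u. prb p ?I (bad1 u)" "2 * q"] b1 by simp
    have "(\<Sum>uv\<in>?X2. prb p ?I (bad2 uv)) \<le> real (card ?X2) * (2 * q)"
      using b2 by (intro sum_bounded_above)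
    also have "\<dots> \<le> real M ^ 2 * (2 * q)"
      using card_mono[OF _ X2] by (intro mult_right_mono)
        (auto simp: q_def power2_eq_square simp flip: of_nat_mult)
    finally show "(\<Sum>uv\<in>?X2. prb p ?I (bad2 uv)) \<le> real M ^ 2 * (2 * q)" .
    have "(\<Sum>SQ\<in>?X3. prb p ?I (bad3 SQ)) \<le> real (card ?X3) * exp (- (4 * m * ln M))"
      using b3 by (intro sum_bounded_above)
    also have "card ?X3 \<le> (M\<^sup>2) ^ m * 2 ^ M"
    proof -
      have "card ?X3 \<le> card ({S. S \<subseteq> {..<M} \<times> {..<M} \<and> card S = m} \<times> Pow {..<M})"
        by (rule card_mono[OF finX3' X3])
      also have "\<dots> = (M * M choose m) * 2 ^ M"
        by (simp add: card_cartesian_product n_subsets card_Pow)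
      also have "\<dots> \<le> (M\<^sup>2) ^ m * 2 ^ M"
        using choose_le_power by (simp add: power2_eq_square)
      finally show ?thesis .
    qed
    then have "real (card ?X3) * exp (- (4 * m * ln M)) \<le> real ((M\<^sup>2) ^ m * 2 ^ M) * exp (- (4 * m * ln M))"
      by (intro mult_right_mono) (auto simp only: of_nat_le_iff exp_ge_zero)
    finally show "(\<Sum>SQ\<in>?X3. prb p ?I (bad3 SQ)) \<le> (M\<^sup>2) ^ m * 2 ^ M * exp (- (4 * m * ln M))"
      by simp
  qed
  \<comment> \<open>With \<open>M \<ge> 3\<close> the three terms are at most
    \<open>2 / M ^ 3\<close>, \<open>2 / M ^ 2\<close> and \<open>exp (- M)\<close>.\<close>
  also have "\<dots> \<le> 2 / 27 + (2 / 9 + 1 / 4)"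
  proof (intro add_mono)
    have M3: "real M ^ 3 \<ge> 3 ^ 3" "real M ^ 2 \<ge> 3 ^ 2" using M by (intro power_mono; simp)+
    have "real M * (2 * q) \<le> real M * (2 * (1 / real M ^ 4))" using qM by (intro mult_left_mono) auto
    also have "\<dots> = 2 / real M ^ 3" using M by (simp add: field_simps eval_nat_numeral)
    also have "\<dots> \<le> 2 / 3 ^ 3" using M3 M by (intro divide_left_mono) auto
    finally show "real M * (2 * q) \<le> 2 / 27" by simp
    have "real M ^ 2 * (2 * q) \<le> real M ^ 2 * (2 * (1 / real M ^ 4))" using qM by (intro mult_left_mono) auto
    also have "\<dots> = 2 / real M ^ 2" using M by (simp add: field_simps eval_nat_numeral)
    also have "\<dots> \<le> 2 / 3 ^ 2" using M3 M by (intro divide_left_mono) auto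
    finally show "real M ^ 2 * (2 * q) \<le> 2 / 9" by simp
    have "2 ^ M \<le> exp (real M)"
    proof -
      have "(2::real) ^ M \<le> exp 1 ^ M"
        using exp_ge_add_one_self[of "1::real"] by (intro power_mono) auto
      also have "\<dots> = exp (real M)" using exp_of_nat_mult[of M "1::real"] by simp
      finally show ?thesis .
    qed
    moreover have "real ((M\<^sup>2) ^ m) = exp (2 * m * ln M)"
      using M exp_of_nat_mult[of "2 * m" "ln (real M)"] by (simp add: power_mult)
    ultimately have "(M\<^sup>2) ^ m * 2 ^ M * exp (- (4 * m * ln M)) \<le>
        exp (2 * m * ln M) * exp (real M) * exp (- (4 * m * ln M))"
      by (intro mult_right_mono mult_mono) auto
    also have "\<dots> = exp (real M - 2 * (real m * ln M))" by (simp add: exp_add[symmetric] algebra_simps)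
    also have "\<dots> \<le> exp (- real M)" using m by simp
    also have "\<dots> \<le> exp (- 3)" using M by simp
    also have "\<dots> \<le> 1 / 4" using exp_ge_add_one_self[of 3] by (simp add: exp_minus field_simps)
    finally show "(M\<^sup>2) ^ m * 2 ^ M * exp (- (4 * m * ln M)) \<le> 1 / 4" .
  qed
  also have "\<dots> < 1" by simp
  finally obtain A where A: "A \<subseteq> ?I" "\<And>u. u < M \<Longrightarrow> \<not> bad1 u A" "\<And>uv. uv \<in> ?X2 \<Longrightarrow> \<not> bad2 uv A"
    "\<And>SQ. SQ \<in> ?X3 \<Longrightarrow> \<not> bad3 SQ A"
    by (rule prb_less_1E[OF finite_arcs]) blast
  have "quasirandom k N m \<epsilon> D d A"
    unfolding quasirandom_def
  proof (intro conjI allI impI)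
    show "A \<subseteq> ?I" by fact
  next
    fix u assume "u < N * k"
    moreover have "{w \<in> P u. Bout u w \<subseteq> A} = A `` {u}"
      using A(1) by (auto simp: P_def Bout_def part_def arcs_def)
    ultimately show "D / 4 \<le> card (A `` {u})" "card (A `` {u}) \<le> 4 * D"
      using A(2)[of u] by (auto simp: M_def bad1_def)
  next
    fix u v assume "u < N * k" "v < N * k" "v mod k = (u + 2) mod k"
    then have "\<not> bad2 (u, v) A" by (intro A(3)) (auto simp: M_def)
    moreover have "mid A u v \<inter> P u = mid A u v"
      using A(1) by (auto simp: P_def mid_def part_def arcs_def)
    then have "card {l \<in> {(u, v)} \<times> P u. hinge l \<subseteq> A} = card (mid A u v)"
      using card_hinge_subset[of "{(u, v)}" "P u" A] finP by simp
    ultimately show "d / 4 \<le> card (mid A u v)" "card (mid A u v) \<le> 4 * d"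
      by (auto simp: bad2_def)
  next
    fix i S Q
    assume i: "i < k"
      and SQ: "S \<subseteq> across k N i \<and> inj_on fst S \<and> inj_on snd S \<and> card S = m \<and>
        Q \<subseteq> part k N i \<and> card Q \<le> \<epsilon> * N / 4"
    then have nb: "\<not> bad3 (S, Q) A" by (intro A(4)) auto
    have "finite S"
      by (rule finite_subset[of _ "{..<M} \<times> {..<M}"]) (use SQ in \<open>auto simp: across_def M_def\<close>)
    moreover have "finite Q" using SQ finite_part finite_subset by blast
    ultimately have card: "card {l \<in> S \<times> Q. hinge l \<subseteq> A} = (\<Sum>(u, v)\<in>S. card (mid A u v \<inter> Q))"
      by (rule card_hinge_subset)
    show "\<exists>(u, v)\<in>S. card (mid A u v \<inter> Q) < \<epsilon> * d"
    proof (rule ccontr)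
      assume "\<not> ?thesis"
      then have "\<epsilon> * d \<le> card (mid A (fst uv) (snd uv) \<inter> Q)" if "uv \<in> S" for uv
        using that by (force simp: not_less)
      then have "card S * (\<epsilon> * d) \<le> (\<Sum>uv\<in>S. real (card (mid A (fst uv) (snd uv) \<inter> Q)))"
        by (rule sum_bounded_below)
      then have "bad3 (S, Q) A"
        using SQ by (simp add: bad3_def card case_prod_unfold mult.assoc)
      with nb show False ..
    qed
  qed
  then show ?thesis ..
qed

section \<open>Counting transversal cycles\<close>

text \<open>A set that meets every class once fixes the cyclic order of its vertices, so transversal
  cycles can be given as bare vertex sets.\<close>

definition cyc_edges :: "nat \<Rightarrow> nat \<Rightarrow> (nat \<times> nat) set \<Rightarrow> nat set set" where
  "cyc_edges k N A = {e. e \<subseteq> {..<N * k} \<and> bij_betw (\<lambda>v. v mod k) e {..<k} \<and>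
     (\<forall>u\<in>e. \<forall>v\<in>e. v mod k = Suc u mod k \<longrightarrow> (u, v) \<in> A)}"

section \<open>Walks and rooted circuits\<close>

definition walks :: "('a \<times> 'a) set \<Rightarrow> 'a \<Rightarrow> nat \<Rightarrow> 'a list set" where
  "walks A v l = {xs. length xs = Suc l \<and> hd xs = v \<and> successively (\<lambda>x y. (x, y) \<in> A) xs}"

lemma walks_0: "walks A v 0 = {[v]}"
  by (auto simp: walks_def length_Suc_conv)

lemma walks_Suc: "walks A v (Suc l) = (\<lambda>(w, xs). v # xs) ` (SIGMA w:A `` {v}. walks A w l)"
proof (intro set_eqI iffI)
  fix xs assume "xs \<in> walks A v (Suc l)"
  then obtain w ys where "xs = v # w # ys" "length (w # ys) = Suc l" "(v, w) \<in> A"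
    "successively (\<lambda>x y. (x, y) \<in> A) (w # ys)"
    by (auto simp: walks_def length_Suc_conv)
  then show "xs \<in> (\<lambda>(w, xs). v # xs) ` (SIGMA w:A `` {v}. walks A w l)"
    by (intro image_eqI[of _ _ "(w, w # ys)"]) (auto simp: walks_def)
qed (auto simp: walks_def successively_Cons)

lemma card_walks:
  fixes lo hi :: real and M :: nat
  assumes A: "A \<subseteq> {..<M} \<times> {..<M}" and lo: "lo \<ge> 0" "hi \<ge> 0"
    and deg: "\<And>u. u < M \<Longrightarrow> lo \<le> card (A `` {u})" "\<And>u. u < M \<Longrightarrow> card (A `` {u}) \<le> hi"
    and v: "v < M"
  shows "finite (walks A v l) \<and> lo ^ l \<le> card (walks A v l) \<and> card (walks A v l) \<le> hi ^ l"
  using v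
proof (induction l arbitrary: v)
  case 0
  show ?case by (simp add: walks_0)
next
  case (Suc l)
  have "A `` {v} \<subseteq> {..<M}" using A by auto
  then have fin: "finite (A `` {v})" by (rule finite_subset) simp
  have IH: "finite (walks A w l)" "lo ^ l \<le> card (walks A w l)" "card (walks A w l) \<le> hi ^ l"
    if "w \<in> A `` {v}" for w
  proof -
    have "w < M" using that A by auto
    from Suc.IH[OF this] show "finite (walks A w l)" "lo ^ l \<le> card (walks A w l)"
      "card (walks A w l) \<le> hi ^ l" by blast+
  qed
  have "inj_on (\<lambda>(w, xs). v # xs) (SIGMA w:A `` {v}. walks A w l)"
    by (auto simp: inj_on_def walks_def)
  then have card: "card (walks A v (Suc l)) = (\<Sum>w\<in>A `` {v}. card (walks A w l))"
    using IH fin by (simp add: walks_Suc card_image)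
  have "lo ^ Suc l \<le> card (A `` {v}) * lo ^ l"
    using deg(1)[OF Suc.prems] lo by (simp add: mult_right_mono)
  also have "\<dots> \<le> (\<Sum>w\<in>A `` {v}. real (card (walks A w l)))"
    using IH by (intro sum_bounded_below)
  finally have 1: "lo ^ Suc l \<le> card (walks A v (Suc l))" by (simp add: card)
  have "(\<Sum>w\<in>A `` {v}. real (card (walks A w l))) \<le> card (A `` {v}) * hi ^ l"
    using IH by (intro sum_bounded_above)
  also have "\<dots> \<le> hi ^ Suc l"
    using deg(2)[OF Suc.prems] lo by (simp add: mult_right_mono)
  finally have 2: "card (walks A v (Suc l)) \<le> hi ^ Suc l" by (simp add: card)
  have "finite (walks A v (Suc l))" unfolding walks_Suc using IH fin by auto
  with 1 2 show ?case by blast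
qed

lemma add_mod_inj:
  fixes k :: nat
  assumes "(v + i) mod k = (v + j) mod k" "i < k" "j < k"
  shows "i = j"
  using assms
proof (induction i j rule: linorder_wlog)
  case (le i j)
  then have "k dvd (v + j) - (v + i)" by (metis mod_eq_dvd_iff_nat add_le_cancel_left)
  then have "k dvd j - i" by simp
  moreover have "j - i < k" using le by simp
  ultimately have "j - i = 0" by (metis nat_dvd_not_less gr0I)
  with le show ?case by simp
qed simp

lemma add_mod_image:
  fixes k :: nat
  shows "(\<lambda>j. (v + j) mod k) ` {..<k} = {..<k}"
proof (cases "k = 0")
  case False
  show ?thesis
  proof (rule card_subset_eq)
    have "inj_on (\<lambda>j. (v + j) mod k) {..<k}"
      by (meson add_mod_inj inj_onI lessThan_iff)
    then show "card ((\<lambda>j. (v + j) mod k) ` {..<k}) = card {..<k}"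
      by (rule card_image)
  qed (use False in auto)
qed simp

text \<open>Fixing the root \<open>v\<close> removes the rotations of a cycle; in the cyclic
  digraphs below, circuits at \<open>v\<close> then correspond to the edges through
  \<open>v\<close>.\<close>

definition circuits :: "nat \<Rightarrow> ('a \<times> 'a) set \<Rightarrow> 'a \<Rightarrow> 'a list set" where
  "circuits k A v = {xs. length xs = k \<and> hd xs = v \<and> successively (\<lambda>x y. (x, y) \<in> A) xs \<and>
     (last xs, hd xs) \<in> A}"

text \<open>All vertices but the last form a walk, and the last is a common neighbour of the walk's
  end and \<open>v\<close>. Hence circuits are counted by \<open>k - 2\<close> out-degrees and one
  codegree.\<close>

lemma circuits_eq:
  assumes "k \<ge> 2"
  shows "circuits k A v =
    (\<lambda>(ys, w). ys @ [w]) ` (SIGMA ys:walks A v (k - 2). mid A (last ys) v)"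
proof (intro set_eqI iffI)
  fix xs assume xs: "xs \<in> circuits k A v"
  then have "xs \<noteq> []" using assms by (auto simp: circuits_def)
  then obtain ys w where [simp]: "xs = ys @ [w]" by (metis append_butlast_last_id)
  have "length ys = Suc (k - 2)" using xs assms by (auto simp: circuits_def)
  moreover from this have "ys \<noteq> []" by auto
  ultimately show "xs \<in> (\<lambda>(ys, w). ys @ [w]) ` (SIGMA ys:walks A v (k - 2). mid A (last ys) v)"
    using xs by (auto simp: circuits_def walks_def mid_def successively_append_iff)
next
  fix xs assume "xs \<in> (\<lambda>(ys, w). ys @ [w]) ` (SIGMA ys:walks A v (k - 2). mid A (last ys) v)"
  then obtain ys w where "xs = ys @ [w]" "ys \<in> walks A v (k - 2)" "w \<in> mid A (last ys) v"
    by auto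
  moreover from this have "ys \<noteq> []" by (auto simp: walks_def)
  ultimately show "xs \<in> circuits k A v"
    using assms by (auto simp: circuits_def walks_def mid_def successively_append_iff)
qed

section \<open>Degrees, size and shadow of the cycle hypergraph\<close>

locale quasirandom_digraph =
  fixes k N m :: nat and \<epsilon> D d :: real and A :: "(nat \<times> nat) set"
  assumes k: "k \<ge> 2" and D: "D \<ge> 0" and d: "d \<ge> 0" and qr: "quasirandom k N m \<epsilon> D d A"
begin

abbreviation "H \<equiv> cyc_edges k N A"

lemma A_arcs: "A \<subseteq> arcs k N"
  using qr by (simp add: quasirandom_def)

lemma A_sub: "A \<subseteq> {..<N * k} \<times> {..<N * k}"
  using A_arcs by (auto simp: arcs_def)

lemma outdegree: "u < N * k \<Longrightarrow> D / 4 \<le> card (A `` {u})" "u < N * k \<Longrightarrow> card (A `` {u}) \<le> 4 * D"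
  using qr unfolding quasirandom_def by blast+

lemma codegree:
  assumes "u < N * k" "v < N * k" "v mod k = (u + 2) mod k"
  shows "d / 4 \<le> card (mid A u v)" "card (mid A u v) \<le> 4 * d"
  using qr assms unfolding quasirandom_def by blast+

lemma arcD: "(u, v) \<in> A \<Longrightarrow> v mod k = Suc u mod k"
  using A_arcs by (auto simp: arcs_def)

lemma k_pos: "k > 0" using k by simp

lemma nth_mod:
  assumes "successively (\<lambda>x y. (x, y) \<in> A) xs" "j < length xs"
  shows "xs ! j mod k = (hd xs + j) mod k"
  using assms(2)
proof (induction j)
  case 0
  then show ?case by (simp add: hd_conv_nth)
next
  case (Suc j)
  then have "(xs ! j, xs ! Suc j) \<in> A"
    using assms(1) by (simp add: successively_conv_nth)
  then have "xs ! Suc j mod k = Suc (xs ! j) mod k" by (rule arcD)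
  also have "\<dots> = Suc ((hd xs + j) mod k) mod k"
    using Suc by (metis Suc_lessD mod_Suc_eq)
  finally show ?case by (simp add: mod_Suc_eq)
qed

lemma set_walk:
  assumes "successively (\<lambda>x y. (x, y) \<in> A) xs" "hd xs < N * k"
  shows "set xs \<subseteq> {..<N * k}"
proof -
  have "xs ! j < N * k" if "j < length xs" for j
  proof (cases j)
    case 0
    then show ?thesis using assms(2) that by (simp add: hd_conv_nth)
  next
    case (Suc i)
    then have "(xs ! i, xs ! Suc i) \<in> A"
      using assms(1) that by (simp add: successively_conv_nth)
    then show ?thesis using A_sub Suc by auto
  qed
  then show ?thesis by (auto simp: in_set_conv_nth)
qed

lemma card_walks_bounds:
  assumes "v < N * k"
  shows "finite (walks A v l)" "(D / 4) ^ l \<le> card (walks A v l)" "card (walks A v l) \<le> (4 * D) ^ l"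
  using card_walks[OF A_sub _ _ outdegree assms, of l] D by simp_all

lemma card_circuits:
  assumes v: "v < N * k"
  shows "finite (circuits k A v)" "(D / 4) ^ (k - 2) * (d / 4) \<le> card (circuits k A v)"
    "card (circuits k A v) \<le> (4 * D) ^ (k - 2) * (4 * d)"
proof -
  let ?W = "walks A v (k - 2)"
  have mid: "d / 4 \<le> card (mid A (last ys) v)" "card (mid A (last ys) v) \<le> 4 * d"
    "finite (mid A (last ys) v)" if ys: "ys \<in> ?W" for ys
  proof -
    have ys': "ys \<noteq> []" "length ys = Suc (k - 2)" "hd ys = v" "successively (\<lambda>x y. (x, y) \<in> A) ys"
      using ys by (auto simp: walks_def)
    then have last: "last ys < N * k" using set_walk[of ys] v last_in_set[of ys] by blast
    \<comment> \<open>The walk ends \<open>k - 2\<close> classes after that of \<open>v\<close>, so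
      \<open>v\<close> lies two classes after \<open>last ys\<close> and the codegree condition
      applies.\<close>
    have "last ys mod k = (v + (k - 2)) mod k"
      using nth_mod[OF ys'(4), of "k - 2"] ys' by (simp add: last_conv_nth)
    then have "(last ys + 2) mod k = (v + (k - 2) + 2) mod k"
      by (metis mod_add_left_eq)
    moreover have "v + (k - 2) + 2 = v + k" using k by simp
    ultimately have "v mod k = (last ys + 2) mod k" by (metis mod_add_self2)
    with last show "d / 4 \<le> card (mid A (last ys) v)" "card (mid A (last ys) v) \<le> 4 * d"
      using codegree v by blast+
    show "finite (mid A (last ys) v)"
    proof (rule finite_subset)
      show "mid A (last ys) v \<subseteq> {..<N * k}" using A_sub by (auto simp: mid_def)
    qed simp
  qed
  note W = card_walks_bounds[OF v, of "k - 2"]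
  show "finite (circuits k A v)" unfolding circuits_eq[OF k] using W(1) mid(3) by auto
  have "inj_on (\<lambda>(ys, w). ys @ [w]) (SIGMA ys:?W. mid A (last ys) v)"
    by (auto simp: inj_on_def)
  then have card: "card (circuits k A v) = (\<Sum>ys\<in>?W. card (mid A (last ys) v))"
    unfolding circuits_eq[OF k] using W(1) mid(3) by (simp add: card_image)
  have "(D / 4) ^ (k - 2) * (d / 4) \<le> card ?W * (d / 4)"
    using W(2) d by (intro mult_right_mono) auto
  also have "\<dots> \<le> (\<Sum>ys\<in>?W. real (card (mid A (last ys) v)))"
    using mid by (intro sum_bounded_below)
  finally show "(D / 4) ^ (k - 2) * (d / 4) \<le> card (circuits k A v)" by (simp add: card)
  have "(\<Sum>ys\<in>?W. real (card (mid A (last ys) v))) \<le> card ?W * (4 * d)"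
    using mid by (intro sum_bounded_above)
  also have "\<dots> \<le> (4 * D) ^ (k - 2) * (4 * d)"
    using W(3) d by (intro mult_right_mono) auto
  finally show "card (circuits k A v) \<le> (4 * D) ^ (k - 2) * (4 * d)" by (simp add: card)
qed

lemma circuit_nth:
  assumes xs: "xs \<in> circuits k A v" and j: "j < k"
  shows "xs ! j mod k = (v + j) mod k" "(xs ! j, xs ! (Suc j mod k)) \<in> A"
proof -
  have xs': "length xs = k" "hd xs = v" "successively (\<lambda>x y. (x, y) \<in> A) xs" "(last xs, hd xs) \<in> A"
    "xs \<noteq> []"
    using xs k by (auto simp: circuits_def)
  show "xs ! j mod k = (v + j) mod k" using nth_mod[OF xs'(3)] xs' j by simp
  show "(xs ! j, xs ! (Suc j mod k)) \<in> A"
  proof (cases "Suc j = k")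
    case True
    then show ?thesis using xs' by (auto simp: last_conv_nth hd_conv_nth)
  next
    case False
    then show ?thesis using xs' j by (simp add: successively_conv_nth)
  qed
qed

lemma set_circuit:
  assumes xs: "xs \<in> circuits k A v" and v: "v < N * k"
  shows "set xs \<in> H" "v \<in> set xs"
proof -
  have xs': "length xs = k" "hd xs = v" "successively (\<lambda>x y. (x, y) \<in> A) xs" "xs \<noteq> []"
    using xs k by (auto simp: circuits_def)
  show "v \<in> set xs" using xs' by auto
  have set: "set xs = (!) xs ` {..<k}" using xs'(1) nth_image[of k xs] by (simp add: lessThan_atLeast0)
  have inj: "inj_on (\<lambda>v. v mod k) (set xs)"
    unfolding set
  proof (rule inj_onI, clarsimp)
    fix i j assume "i < k" "j < k" "xs ! i mod k = xs ! j mod k"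
    then show "xs ! i = xs ! j" using circuit_nth(1)[OF xs] add_mod_inj by metis
  qed
  have "(\<lambda>v. v mod k) ` set xs = {..<k}"
  proof -
    have "(\<lambda>j. xs ! j mod k) ` {..<k} = (\<lambda>j. (v + j) mod k) ` {..<k}"
      by (intro image_cong) (simp_all add: circuit_nth(1)[OF xs])
    then show ?thesis by (simp only: set image_image add_mod_image)
  qed
  with inj have "bij_betw (\<lambda>v. v mod k) (set xs) {..<k}" by (simp add: bij_betw_def)
  \<comment> \<open>Classes identify the vertices of the circuit, so a vertex one class after
    \<open>u\<close> must be the successor of \<open>u\<close> on it.\<close>
  moreover have "(u, w) \<in> A" if uw: "u \<in> set xs" "w \<in> set xs" "w mod k = Suc u mod k" for u w
  proof -
    obtain j where j: "j < k" "u = xs ! j" using uw(1) unfolding set by auto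
    have "xs ! (Suc j mod k) mod k = Suc u mod k"
      using arcD[OF circuit_nth(2)[OF xs j(1)]] j(2) by simp
    moreover have "xs ! (Suc j mod k) \<in> set xs" using xs'(1) k_pos by simp
    ultimately have "w = xs ! (Suc j mod k)"
      using inj uw(2,3) by (auto simp: inj_on_def)
    then show ?thesis using circuit_nth(2)[OF xs j(1)] j(2) by simp
  qed
  ultimately show "set xs \<in> H"
    using set_walk[OF xs'(3)] v xs'(2) unfolding cyc_edges_def by blast
qed

lemma inj_on_set_circuits: "inj_on set (circuits k A v)" if v: "v < N * k"
proof (rule inj_onI)
  fix xs ys assume xs: "xs \<in> circuits k A v" and ys: "ys \<in> circuits k A v" and eq: "set xs = set ys"
  have inj: "inj_on (\<lambda>v. v mod k) (set xs)"
    using set_circuit(1)[OF xs v] by (auto simp: cyc_edges_def bij_betw_def)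
  have len: "length xs = k" "length ys = k" using xs ys by (auto simp: circuits_def)
  show "xs = ys"
  proof (rule nth_equalityI)
    fix j assume "j < length xs"
    then have j: "j < k" using len by simp
    then have "xs ! j mod k = ys ! j mod k" using circuit_nth(1) xs ys by simp
    moreover have "xs ! j \<in> set xs" "ys ! j \<in> set xs" using j len eq nth_mem[of j xs] nth_mem[of j ys] by auto
    ultimately show "xs ! j = ys ! j" using inj by (auto simp: inj_on_def)
  qed (use len in simp)
qed

lemma edgeD:
  assumes "e \<in> H"
  shows "finite e" "card e = k" "e \<subseteq> {..<N * k}"
proof -
  have e: "e \<subseteq> {..<N * k}" "bij_betw (\<lambda>v. v mod k) e {..<k}"
    using assms by (auto simp: cyc_edges_def)
  then show "finite e" "card e = k" "e \<subseteq> {..<N * k}"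
    using finite_subset bij_betw_same_card by fastforce+
qed

lemma finite_H: "finite H"
  by (rule finite_subset[of _ "Pow {..<N * k}"]) (auto simp: cyc_edges_def)

lemma circuit_of_edge:
  assumes e: "e \<in> H" and v: "v \<in> e"
  obtains xs where "xs \<in> circuits k A v" "set xs = e"
proof -
  have bij: "bij_betw (\<lambda>v. v mod k) e {..<k}"
    and A: "\<And>u w. u \<in> e \<Longrightarrow> w \<in> e \<Longrightarrow> w mod k = Suc u mod k \<Longrightarrow> (u, w) \<in> A"
    using e by (auto simp: cyc_edges_def)
  \<comment> \<open>\<open>el j\<close> is the vertex of \<open>e\<close> in class
    \<open>j mod k\<close>. Reading it for \<open>j\<close> from \<open>v\<close> to
    \<open>v + k - 1\<close> uses the number \<open>v\<close> as its own class offset, so the list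
    starts at \<open>v\<close>.\<close>
  define el where "el j = inv_into e (\<lambda>v. v mod k) (j mod k)" for j
  have "j mod k \<in> (\<lambda>v. v mod k) ` e" for j
    using bij k_pos by (auto simp: bij_betw_def)
  then have el: "el j \<in> e" "el j mod k = j mod k" for j
    unfolding el_def by (auto intro: inv_into_into f_inv_into_f)
  have el_eq: "el j = u" if "u \<in> e" "u mod k = j mod k" for u j
    using el[of j] that bij by (auto simp: bij_betw_def inj_on_def)
  have el_A: "(el i, el j) \<in> A" if "j mod k = Suc i mod k" for i j
    using el that by (intro A) (simp_all, metis mod_Suc_eq)
  define xs where "xs = map el [v..<v + k]"
  have len: "length xs = k" and nth: "\<And>j. j < k \<Longrightarrow> xs ! j = el (v + j)" by (auto simp: xs_def)
  have "xs \<noteq> []" using len k by auto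
  then have hd: "hd xs = v" using nth[of 0] k_pos el_eq[OF v] by (simp add: hd_conv_nth)
  have "successively (\<lambda>x y. (x, y) \<in> A) xs"
    by (auto simp: successively_conv_nth len nth intro!: el_A)
  moreover have "(last xs, hd xs) \<in> A"
  proof -
    have "last xs = el (v + (k - 1))"
      using \<open>xs \<noteq> []\<close> k_pos len by (simp add: last_conv_nth nth)
    moreover have "hd xs = el v" using hd el_eq[OF v] by simp
    moreover have "v mod k = Suc (v + (k - 1)) mod k" using k_pos by simp
    ultimately show ?thesis using el_A by simp
  qed
  moreover have "set xs = e"
  proof
    show "set xs \<subseteq> e" using el by (auto simp: xs_def)
    show "e \<subseteq> set xs"
    proof
      fix u assume u: "u \<in> e"
      have "u mod k \<in> (\<lambda>j. (v + j) mod k) ` {..<k}" unfolding add_mod_image using k_pos by simp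
      then obtain j where j: "j < k" "u mod k = (v + j) mod k" by auto
      then have "u = xs ! j" using el_eq[OF u] nth by simp
      then show "u \<in> set xs" using j len by simp
    qed
  qed
  ultimately show ?thesis using that len hd by (auto simp: circuits_def)
qed

lemma degree_le:
  assumes v: "v < N * k"
  shows "card {e \<in> H. v \<in> e} \<le> (4 * D) ^ (k - 2) * (4 * d)"
proof -
  have "{e \<in> H. v \<in> e} \<subseteq> set ` circuits k A v"
    using circuit_of_edge by blast
  then have "card {e \<in> H. v \<in> e} \<le> card (circuits k A v)"
    using card_circuits(1)[OF v] by (meson card_image_le card_mono finite_imageI le_trans)
  with card_circuits(3)[OF v] show ?thesis by linarith
qed

lemma degree_ge:
  assumes v: "v < N * k"
  shows "card {e \<in> H. v \<in> e} \<ge> (D / 4) ^ (k - 2) * (d / 4)"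
proof -
  have "card (circuits k A v) = card (set ` circuits k A v)"
    using inj_on_set_circuits[OF v] by (simp add: card_image)
  also have "\<dots> \<le> card {e \<in> H. v \<in> e}"
    using set_circuit[OF _ v] finite_H by (intro card_mono) auto
  finally show ?thesis using card_circuits(2)[OF v] by linarith
qed

lemma card_touching_le:
  assumes Z: "finite Z" "Z \<subseteq> {..<N * k}"
  shows "card {e \<in> H. e \<inter> Z \<noteq> {}} \<le> card Z * ((4 * D) ^ (k - 2) * (4 * d))"
proof -
  have "{e \<in> H. e \<inter> Z \<noteq> {}} = (\<Union>v\<in>Z. {e \<in> H. v \<in> e})" by auto
  then have "card {e \<in> H. e \<inter> Z \<noteq> {}} \<le> (\<Sum>v\<in>Z. card {e \<in> H. v \<in> e})"
    using card_UN_le[OF Z(1)] by simp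
  then have "real (card {e \<in> H. e \<inter> Z \<noteq> {}}) \<le> (\<Sum>v\<in>Z. real (card {e \<in> H. v \<in> e}))"
    by (simp flip: of_nat_sum)
  also have "\<dots> \<le> card Z * ((4 * D) ^ (k - 2) * (4 * d))"
    using degree_le Z(2) by (intro sum_bounded_above) auto
  finally show ?thesis .
qed

lemma card_H_le: "card H \<le> real (N * k) * ((4 * D) ^ (k - 2) * (4 * d))"
proof -
  have "e \<inter> {..<N * k} \<noteq> {}" if "e \<in> H" for e
  proof -
    have "e \<noteq> {}" using edgeD(2)[OF that] k by auto
    then show ?thesis using edgeD(3)[OF that] by blast
  qed
  then have "{e \<in> H. e \<inter> {..<N * k} \<noteq> {}} = H" by blast
  then show ?thesis using card_touching_le[of "{..<N * k}"] by simp
qed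

text \<open>An edge has at most one vertex in class \<open>0\<close>, so the degrees in that class
  add up without double counting.\<close>

lemma card_H_ge: "card H \<ge> real N * ((D / 4) ^ (k - 2) * (d / 4))"
proof -
  have "u = v" if "u \<in> e" "v \<in> e" "e \<in> H" "u \<in> part k N 0" "v \<in> part k N 0" for u v e
    using that by (auto simp: cyc_edges_def bij_betw_def inj_on_def part_def)
  then have "card (\<Union>v\<in>part k N 0. {e \<in> H. v \<in> e}) = (\<Sum>v\<in>part k N 0. card {e \<in> H. v \<in> e})"
    using finite_H finite_part by (intro card_UN_disjoint) auto
  moreover have "card (\<Union>v\<in>part k N 0. {e \<in> H. v \<in> e}) \<le> card H"
    using finite_H by (intro card_mono) auto
  ultimately have "(\<Sum>v\<in>part k N 0. real (card {e \<in> H. v \<in> e})) \<le> card H"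
    by (simp flip: of_nat_sum)
  moreover have "card (part k N 0) * ((D / 4) ^ (k - 2) * (d / 4)) \<le>
      (\<Sum>v\<in>part k N 0. real (card {e \<in> H. v \<in> e}))"
    using degree_ge by (intro sum_bounded_below) (auto simp: part_def)
  ultimately show ?thesis using card_part[OF k_pos] by simp
qed

text \<open>Rooting an edge at the removed vertex leaves a walk with \<open>k - 2\<close> arcs that
  spans the shadow set. Compared with the edges a factor \<open>d\<close> is missing, which is why
  shadow degrees of order \<open>d / r\<close> survive the cleaning.\<close>

lemma card_shadow_H: "card (shadow H) \<le> real (N * k) * (4 * D) ^ (k - 2)"
proof -
  have "shadow H \<subseteq> (\<Union>v<N * k. set ` walks A v (k - 2))"
  proof
    fix t assume "t \<in> shadow H"
    then obtain w where w: "w \<notin> t" "insert w t \<in> H" by (auto simp: shadow_def)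
    obtain xs where xs: "xs \<in> circuits k A w" "set xs = insert w t"
      using circuit_of_edge[OF w(2)] by auto
    have "length xs = k" using xs(1) by (auto simp: circuits_def)
    then have "distinct xs" using xs(2) edgeD(2)[OF w(2)] by (simp add: card_distinct)
    moreover obtain ys where ys: "xs = w # ys"
      using xs(1) k by (cases xs) (auto simp: circuits_def)
    ultimately have "set ys = t" using xs(2) w(1) by auto
    moreover have "ys \<noteq> []" "length ys = Suc (k - 2)" using \<open>length xs = k\<close> ys k by auto
    moreover have "successively (\<lambda>x y. (x, y) \<in> A) ys"
      using xs(1) ys \<open>ys \<noteq> []\<close> by (auto simp: circuits_def successively_Cons)
    moreover have "hd ys < N * k"
      using hd_in_set[OF \<open>ys \<noteq> []\<close>] \<open>set ys = t\<close> edgeD(3)[OF w(2)] by auto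
    ultimately show "t \<in> (\<Union>v<N * k. set ` walks A v (k - 2))"
      by (auto simp: walks_def)
  qed
  then have "card (shadow H) \<le> card (\<Union>v<N * k. set ` walks A v (k - 2))"
    using card_walks_bounds(1) by (intro card_mono) auto
  also have "\<dots> \<le> (\<Sum>v<N * k. card (set ` walks A v (k - 2)))"
    by (rule card_UN_le) simp
  also have "\<dots> \<le> (\<Sum>v<N * k. card (walks A v (k - 2)))"
    using card_walks_bounds(1) by (intro sum_mono card_image_le) auto
  finally have "real (card (shadow H)) \<le> (\<Sum>v<N * k. real (card (walks A v (k - 2))))"
    by (simp flip: of_nat_sum)
  also have "\<dots> \<le> card {..<N * k} * (4 * D) ^ (k - 2)"
    using card_walks_bounds(3) by (intro sum_bounded_above) auto
  finally show ?thesis by simp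
qed

text \<open>A shadow set misses exactly one class \<open>i\<close>. An extension must fill it and be
  joined to the vertices \<open>u\<close> and \<open>v\<close> in the two neighbouring
  classes.\<close>

lemma shadow_ends:
  assumes "t \<in> shadow H"
  shows "\<exists>i<k. \<exists>u\<in>t. \<exists>v\<in>t. (u, v) \<in> across k N i \<and>
    (\<forall>w. insert w t \<in> H \<longrightarrow> w \<in> mid A u v \<and> w \<in> part k N i)"
proof -
  obtain w0 where w0: "w0 \<notin> t" "insert w0 t \<in> H" using assms by (auto simp: shadow_def)
  define i where "i = w0 mod k"
  have bij0: "bij_betw (\<lambda>v. v mod k) (insert w0 t) {..<k}" and lt: "insert w0 t \<subseteq> {..<N * k}"
    using w0(2) by (auto simp: cyc_edges_def)
  then have inj0: "inj_on (\<lambda>v. v mod k) (insert w0 t)"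
    and im0: "(\<lambda>v. v mod k) ` insert w0 t = {..<k}" by (auto simp: bij_betw_def)
  have i: "i < k" using k_pos by (simp add: i_def)
  have ex: "\<exists>u\<in>t. u mod k = j" if "j < k" "j \<noteq> i" for j
  proof -
    have "j \<in> (\<lambda>v. v mod k) ` insert w0 t" unfolding im0 using that(1) by simp
    then show ?thesis using that(2) by (auto simp: i_def)
  qed
  define a where "a = (if i = 0 then k - 1 else i - 1)"
  have a: "a < k" "a \<noteq> i" "Suc a mod k = i" using i k by (auto simp: a_def)
  have b: "Suc i mod k < k" "Suc i mod k \<noteq> i"
    using k_pos Suc_mod_neq[OF k, of i] i by auto
  obtain u v where uv: "u \<in> t" "u mod k = a" "v \<in> t" "v mod k = Suc i mod k"
    using ex[OF a(1,2)] ex[OF b] by auto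
  have Su: "Suc u mod k = i" using a(3) uv(2) by (metis mod_Suc_eq)
  have "(u, v) \<in> across k N i" using uv lt Su by (auto simp: across_def)
  moreover have "w \<in> mid A u v \<and> w \<in> part k N i" if w: "insert w t \<in> H" for w
  proof -
    have bij: "bij_betw (\<lambda>v. v mod k) (insert w t) {..<k}"
      and adj: "\<And>x y. x \<in> insert w t \<Longrightarrow> y \<in> insert w t \<Longrightarrow> y mod k = Suc x mod k \<Longrightarrow> (x, y) \<in> A"
      using w by (auto simp: cyc_edges_def)
    have "i \<in> (\<lambda>v. v mod k) ` insert w t" using bij i by (auto simp: bij_betw_def)
    moreover have "i \<notin> (\<lambda>v. v mod k) ` t"
      using inj0 w0(1) by (auto simp: i_def inj_on_def)
    ultimately have wi: "w mod k = i" by auto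
    have "(u, w) \<in> A" using uv Su wi by (intro adj) auto
    moreover have "(w, v) \<in> A" using uv wi by (intro adj) (auto simp: mod_Suc_eq)
    ultimately show ?thesis using wi edgeD(3)[OF w] by (auto simp: mid_def part_def)
  qed
  ultimately show ?thesis using i uv(1,3) by blast
qed

end

section \<open>The size-Ramsey number\<close>

text \<open>This is the pigeonhole principle, multiplied out to avoid division. It serves for the
  colours and for the missing classes of shadow sets.\<close>

lemma exists_large_fibre:
  fixes f :: "'a \<Rightarrow> nat"
  assumes "finite X" "f ` X \<subseteq> {..<r}" "r > 0"
  shows "\<exists>c<r. card X \<le> r * card {x \<in> X. f x = c}"
proof (rule ccontr)
  assume "\<not> ?thesis"
  then have lt: "r * card {x \<in> X. f x = c} < card X" if "c < r" for c
    using that by force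
  have "card X = (\<Sum>c<r. card {x \<in> X. f x = c})"
    using sum.group[of X "{..<r}" f "\<lambda>_. 1 :: nat"] assms(1,2) by simp
  then have "r * card X = (\<Sum>c<r. r * card {x \<in> X. f x = c})"
    by (simp add: sum_distrib_left)
  also have "\<dots> < (\<Sum>c<r. card X)"
    using lt assms(3) by (intro sum_strict_mono) auto
  finally show False by simp
qed

section \<open>The Ramsey property of the cycle hypergraph\<close>

context quasirandom_digraph
begin

lemma expansion:
  assumes "i < k" "S \<subseteq> across k N i" "inj_on fst S" "inj_on snd S" "card S = m"
    "Q \<subseteq> part k N i" "card Q \<le> \<epsilon> * N / 4"
  shows "\<exists>(u, v)\<in>S. card (mid A u v \<inter> Q) < \<epsilon> * d"
  using qr assms unfolding quasirandom_def by blast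

text \<open>Among \<open>k * m\<close> shadow sets, \<open>m\<close> miss the same class.
  Disjointness makes their end pairs injective in both coordinates, so by expansion one pair has
  fewer than \<open>\<epsilon> * d\<close> common neighbours in \<open>Q\<close>. Its shadow set has
  at least \<open>\<epsilon> * d\<close> extensions, so one of them lies outside
  \<open>Q\<close>.\<close>

lemma expanding_family:
  assumes G: "G \<subseteq> H" and rich: "\<And>t. t \<in> shadow G \<Longrightarrow> \<epsilon> * d \<le> card {w. w \<notin> t \<and> insert w t \<in> G}"
    and T: "T \<subseteq> shadow G" "card T = k * m" "pairwise disjnt T" and m: "m > 0"
    and Q: "finite Q" "card Q \<le> \<epsilon> * N / 4"
  shows "\<exists>t\<in>T. \<exists>w. insert w t \<in> G \<and> w \<notin> Q"
proof -
  have shad: "shadow G \<subseteq> shadow H" using G by (auto simp: shadow_def)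
  then have "\<forall>t\<in>T. \<exists>i u v. i < k \<and> u \<in> t \<and> v \<in> t \<and> (u, v) \<in> across k N i \<and>
      (\<forall>w. insert w t \<in> H \<longrightarrow> w \<in> mid A u v \<and> w \<in> part k N i)"
    using T(1) shadow_ends by blast
  then obtain i u v where iuv: "\<And>t. t \<in> T \<Longrightarrow> i t < k" "\<And>t. t \<in> T \<Longrightarrow> u t \<in> t" "\<And>t. t \<in> T \<Longrightarrow> v t \<in> t"
      "\<And>t. t \<in> T \<Longrightarrow> (u t, v t) \<in> across k N (i t)"
      "\<And>t w. t \<in> T \<Longrightarrow> insert w t \<in> H \<Longrightarrow> w \<in> mid A (u t) (v t) \<and> w \<in> part k N (i t)"
    by metis
  have "finite T" using T(2) m k by (intro card_ge_0_finite) simp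
  then obtain c where c: "c < k" "card T \<le> k * card {t \<in> T. i t = c}"
    using exists_large_fibre[of T i k] iuv(1) k_pos by auto
  then have "m \<le> card {t \<in> T. i t = c}" using T(2) k by simp
  then obtain T' where T': "T' \<subseteq> {t \<in> T. i t = c}" "card T' = m"
    by (meson obtain_subset_with_card_n)
  have sep: "t = t'" if "t \<in> T'" "t' \<in> T'" "x \<in> t" "x \<in> t'" for t t' x
    using that T' T(3) unfolding pairwise_def disjnt_def by blast
  have inj: "inj_on u T'" "inj_on v T'"
    using iuv(2,3) T'(1) sep by (intro inj_onI; metis (no_types, lifting) mem_Collect_eq subsetD)+
  define S where "S = (\<lambda>t. (u t, v t)) ` T'"
  have "inj_on (\<lambda>t. (u t, v t)) T'" using inj(1) by (auto simp: inj_on_def)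
  then have "card S = m" using T'(2) by (simp add: S_def card_image)
  moreover have "S \<subseteq> across k N c" using iuv(4) T'(1) by (auto simp: S_def)
  moreover have "inj_on fst S" "inj_on snd S" using inj by (auto simp: S_def inj_on_def)
  moreover have "card (Q \<inter> part k N c) \<le> \<epsilon> * N / 4"
    using card_mono[OF Q(1), of "Q \<inter> part k N c"] Q(2) by simp
  ultimately have "\<exists>(u, v)\<in>S. card (mid A u v \<inter> (Q \<inter> part k N c)) < \<epsilon> * d"
    using c(1) by (intro expansion[of c]) auto
  then obtain t where t: "t \<in> T'" "card (mid A (u t) (v t) \<inter> (Q \<inter> part k N c)) < \<epsilon> * d"
    by (auto simp: S_def)
  have tT: "t \<in> T" "i t = c" using t T' by auto
  let ?W = "{w. w \<notin> t \<and> insert w t \<in> G}"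
  have W: "?W \<subseteq> mid A (u t) (v t) \<inter> part k N c"
    using iuv(5)[OF tT(1)] G tT(2) by blast
  have "\<epsilon> * d \<le> card ?W" using rich T(1) tT(1) by blast
  have "\<not> ?W \<subseteq> Q"
  proof
    assume "?W \<subseteq> Q"
    then have "card ?W \<le> card (mid A (u t) (v t) \<inter> (Q \<inter> part k N c))"
      using W Q(1) by (intro card_mono) auto
    with t(2) \<open>\<epsilon> * d \<le> card ?W\<close> show False by simp
  qed
  then show ?thesis using tT(1) by blast
qed

text \<open>The upper bound on \<open>\<epsilon>\<close> keeps half of the guaranteed size
  \<open>card H / r\<close> of the majority colour after cleaning. \<open>nm\<close> keeps the
  visited set within reach of the expansion, and \<open>mN\<close> ensures that the discarded
  vertices meet fewer edges than remain.\<close>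

lemma arrows_tight_path:
  assumes Dd: "D > 0" "d > 0" and r: "r > 0" and m: "m > 0" and N: "N > 0"
    and \<epsilon>: "\<epsilon> \<ge> 0" "\<epsilon> * (2 * r * k * 4 ^ (2 * k - 3)) \<le> 1"
    and nm: "n + 2 * k * (k * m) \<le> \<epsilon> * N / 4"
    and mN: "2 * k * (k * m) * (2 * r * 4 ^ (2 * k - 2)) < real N"
  shows "arrows \<lparr>verts = UNIV, edges = H\<rparr> (tight_path k n) r"
  unfolding arrows_def
proof
  fix f assume f: "f \<in> edges \<lparr>verts = UNIV, edges = H\<rparr> \<rightarrow> {..<r}"
  \<comment> \<open>All vertex degrees of \<open>H\<close> lie within a factor
    \<open>4 ^ (k - 1)\<close> of \<open>\<delta>\<close>.\<close>
  define \<delta> where "\<delta> = D ^ (k - 2) * d"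
  have \<delta>: "\<delta> > 0" using Dd by (simp add: \<delta>_def)
  have k1: "k - 1 = Suc (k - 2)" using k by simp
  have e1: "(4 * D) ^ (k - 2) * (4 * d) = 4 ^ (k - 1) * \<delta>"
    and e2: "(D / 4) ^ (k - 2) * (d / 4) = \<delta> / 4 ^ (k - 1)"
    unfolding k1 by (simp_all add: \<delta>_def power_mult_distrib power_divide)
  have Hge: "card H \<ge> N * \<delta> / 4 ^ (k - 1)" using card_H_ge unfolding e2 by simp
  obtain c where c: "c < r" "card H \<le> r * card {e \<in> H. f e = c}"
    using exists_large_fibre[of H f r] finite_H f r by auto
  define F where "F = {e \<in> H. f e = c}"
  have F: "finite F" "F \<subseteq> H" "card H \<le> r * real (card F)"
    using finite_H c(2) by (auto simp: F_def simp flip: of_nat_mult)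
  have "finite (shadow H)"
    by (rule finite_subset[of _ "Pow {..<N * k}"]) (auto simp: shadow_def cyc_edges_def)
  then have "card (shadow F) \<le> card (shadow H)"
    using F(2) by (intro card_mono) (auto simp: shadow_def)
  then have shF: "card (shadow F) \<le> real (N * k) * (4 * D) ^ (k - 2)"
    using card_shadow_H by linarith
  have fin: "finite e" if "e \<in> F" for e using that F(2) edgeD by blast
  have "0 \<le> \<epsilon> * d" using \<epsilon> Dd by simp
  from exists_rich_subfamily[OF F(1) fin this]
  obtain G where G: "G \<subseteq> F" "real (card F) - \<epsilon> * d * card (shadow F) \<le> card G"
    and rich: "\<And>t. t \<in> shadow G \<Longrightarrow> \<epsilon> * d \<le> card {w. w \<notin> t \<and> insert w t \<in> G}"
    by blast
  have GH: "G \<subseteq> H" using G F by blast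
  have Gge: "real (card H) / (2 * r) \<le> card G"
  proof -
    have "\<epsilon> * d * card (shadow F) \<le> \<epsilon> * d * (real (N * k) * (4 * D) ^ (k - 2))"
      using shF \<epsilon> Dd by (intro mult_left_mono) auto
    also have "\<dots> = \<epsilon> * (2 * r * k * 4 ^ (2 * k - 3)) * (N * \<delta> / 4 ^ (k - 1) / (2 * r))"
    proof -
      have "(4::real) ^ (2 * k - 3) = 4 ^ (k - 2) * 4 ^ (k - 1)"
        using k by (simp flip: power_add)
      then show ?thesis using r by (simp add: \<delta>_def power_mult_distrib)
    qed
    also have "\<dots> \<le> 1 * (N * \<delta> / 4 ^ (k - 1) / (2 * r))"
      using \<epsilon>(2) \<delta> by (intro mult_right_mono) auto
    also have "\<dots> \<le> card H / (2 * r)"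
      using divide_right_mono[OF Hge, of "2 * real r"] by simp
    finally have "\<epsilon> * d * card (shadow F) \<le> card H / (2 * r)" .
    moreover have "card H / r \<le> card F" using F(3) r by (simp add: field_simps)
    moreover have "card H / r = card H / (2 * r) + card H / (2 * r)" by (simp add: field_simps)
    ultimately show ?thesis using G(2) by linarith
  qed
  have "\<exists>p. tight_list G k p \<and> n \<le> length p"
  proof (rule tight_list_exists[OF k])
    show "finite e \<and> card e = k" if "e \<in> G" for e using that GH edgeD by blast
  next
    fix Z :: "nat set" assume Z: "finite Z" "card Z \<le> 2 * k * (k * m)"
    \<comment> \<open>\<open>Z\<close> may contain numbers outside the digraph, where the degree
      bounds say nothing.\<close>
    let ?Z = "Z \<inter> {..<N * k}"
    have cZ: "card ?Z \<le> 2 * k * (k * m)" using Z card_mono[of Z ?Z] by auto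
    have "card {e \<in> H. e \<inter> ?Z \<noteq> {}} \<le> card ?Z * (4 ^ (k - 1) * \<delta>)"
      using card_touching_le[of ?Z] Z(1) unfolding e1 by simp
    also have "\<dots> \<le> real (2 * k * (k * m)) * (4 ^ (k - 1) * \<delta>)"
      using cZ \<delta> by (intro mult_right_mono) (auto simp only: of_nat_le_iff, simp)
    also have "\<dots> = 2 * k * (k * m) * (2 * r * 4 ^ (2 * k - 2)) * (\<delta> / 4 ^ (k - 1) / (2 * r))"
    proof -
      have "(4::real) ^ (2 * k - 2) = 4 ^ (k - 1) * 4 ^ (k - 1)"
        using k by (simp flip: power_add)
      then show ?thesis using r by simp
    qed
    also have "\<dots> < N * (\<delta> / 4 ^ (k - 1) / (2 * r))"
      using mN \<delta> r by (intro mult_strict_right_mono) auto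
    also have "\<dots> \<le> card H / (2 * r)"
      using divide_right_mono[OF Hge, of "2 * real r"] by simp
    also have "\<dots> \<le> card G" by (rule Gge)
    finally have lt: "card {e \<in> H. e \<inter> ?Z \<noteq> {}} < card G" by simp
    show "\<exists>e\<in>G. e \<inter> Z = {}"
    proof (rule ccontr)
      assume *: "\<not> ?thesis"
      have "G \<subseteq> {e \<in> H. e \<inter> ?Z \<noteq> {}}"
      proof
        fix e assume e: "e \<in> G"
        then have "e \<in> H" "e \<inter> Z \<noteq> {}" using * GH by auto
        moreover from this have "e \<subseteq> {..<N * k}" using edgeD(3) by blast
        ultimately show "e \<in> {e \<in> H. e \<inter> ?Z \<noteq> {}}" by blast
      qed
      then have "card G \<le> card {e \<in> H. e \<inter> ?Z \<noteq> {}}" using finite_H by (intro card_mono) auto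
      with lt show False by simp
    qed
  next
    fix T :: "nat set set" and Q :: "nat set"
    assume T: "T \<subseteq> shadow G" "card T = k * m" "pairwise disjnt T"
      and Q: "finite Q" "card Q \<le> n + 2 * k * (k * m)"
    have "card Q \<le> \<epsilon> * N / 4" using Q(2) nm by linarith
    then show "\<exists>t\<in>T. \<exists>w. insert w t \<in> G \<and> w \<notin> Q"
      using expanding_family[OF GH rich T m Q(1)] by blast
  qed
  then obtain p where p: "tight_list G k p" "n \<le> length p" by blast
  \<comment> \<open>The vertices of \<open>tight_path\<close> start at \<open>1\<close>, list
    positions at \<open>0\<close>.\<close>
  define \<phi> where "\<phi> i = p ! (i - 1)" for i
  have "inj_on \<phi> {1..n}"
    using p by (auto simp: inj_on_def \<phi>_def tight_list_def nth_eq_iff_index_eq)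
  moreover have "\<phi> ` {i..<i + k} \<in> G" if i: "1 \<le> i" "i + k \<le> n + 1" for i
  proof -
    have "(\<lambda>i. i - 1) ` {i..<i + k} = {i - 1..<i - 1 + k}"
    proof -
      have "j \<in> (\<lambda>i. i - 1) ` {i..<i + k}" if "j \<in> {i - 1..<i - 1 + k}" for j
        using that i by (intro image_eqI[of _ _ "Suc j"]) auto
      then show ?thesis using i by auto
    qed
    then have "\<phi> ` {i..<i + k} = (!) p ` {i - 1..<i - 1 + k}"
      unfolding \<phi>_def by (metis image_image)
    also have "i - 1 + k \<le> length p" using p i by simp
    then have "(!) p ` {i - 1..<i - 1 + k} \<in> G" using p(1) unfolding tight_list_def by blast
    finally show ?thesis .
  qed
  ultimately show "monochromatic_copy (tight_path k n) \<lparr>verts = UNIV, edges = H\<rparr> f"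
    unfolding monochromatic_copy_def tight_path_def
    using G(1) by (intro exI[of _ \<phi>] exI[of _ c]) (auto simp: F_def)
qed

text \<open>Isolated vertices cost nothing, so the host may have all natural numbers as
  vertices.\<close>

lemma size_Ramsey_le_card_H:
  assumes "arrows \<lparr>verts = UNIV, edges = H\<rparr> G r"
  shows "size_Ramsey k G r \<le> card H"
  unfolding size_Ramsey_def
proof (rule wellorder_Inf_le1, intro CollectI exI conjI)
  let ?H = "\<lparr>verts = UNIV, edges = H\<rparr> :: nat hypergraph"
  show "card H = card (edges ?H)" by simp
  show "uniform_hypergraph k ?H" "finite (edges ?H)"
    using edgeD finite_H by (auto simp: uniform_hypergraph_def nsets_def)
qed fact

end

section \<open>Choice of the parameters\<close>

lemma two_ln_le:
  assumes "x \<ge> 8"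
  shows "2 * ln x \<le> (x::real)"
proof -
  \<comment> \<open>With \<open>ln 4 \<le> 3\<close> this gives \<open>ln x \<le> x / 4 + 2\<close>,
    which is at most \<open>x / 2\<close> from \<open>8\<close> on.\<close>
  have "ln (x / 4) \<le> x / 4 - 1" using assms by (intro ln_le_minus_one) auto
  moreover have "ln (x / 4) = ln x - ln 4" using assms by (simp add: ln_div)
  moreover have "ln (4::real) \<le> 4 - 1" by (rule ln_le_minus_one) simp
  ultimately show ?thesis using assms by linarith
qed

text \<open>\<open>N\<close> is chosen so that \<open>\<epsilon> * N / 4 = 4 * n\<close>, which
  leaves room for \<open>n\<close> path vertices and at most \<open>2 * n\<close> discarded ones.
  The number of edges is \<open>D ^ k\<close> up to constants, and \<open>D\<close> is of order
  \<open>r * sqrt (n * ln n)\<close>.\<close>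

lemma size_Ramsey_tight_path_le:
  fixes k r n :: nat
  defines "c \<equiv> 2 * k * 4 ^ (2 * k)"
  assumes k: "k \<ge> 2" and r: "r > 0"
    and n: "n \<ge> 8" "n \<ge> 16 * c * r * k" "n \<ge> 2 * k\<^sup>2"
    and ln_n: "ln n \<ge> 2 * k\<^sup>2 * (16 * c * r * k)"
  shows "size_Ramsey k (tight_path k n) r \<le> k * 4 ^ (k - 1) * (32 * c * r * sqrt (n * ln n)) ^ k"
proof -
  define N where "N = 16 * c * r * n"
  define M where "M = N * k"
  \<comment> \<open>This is the least \<open>m\<close> with \<open>M \<le> m * ln M\<close>, as the
    union bound requires.\<close>
  define m where "m = nat \<lceil>M / ln M\<rceil>"
  define \<epsilon> where "\<epsilon> = 1 / (c * real r)"
  define d where "d = 16 / \<epsilon> * ln M"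
  define D where "D = sqrt (N * d)"
  have c: "c > 0" using k by (simp add: c_def)
  have N: "N > 0" using c r n by (simp add: N_def)
  have nM: "n \<le> M"
  proof -
    have "1 * n \<le> (16 * c * r * k) * n" using c r k by (intro mult_le_mono1) (simp add: Suc_le_eq)
    then show ?thesis by (simp add: M_def N_def algebra_simps)
  qed
  have M_eq: "real M = (16 * c * r * k) * real n" by (simp add: M_def N_def)
  \<comment> \<open>The threshold on \<open>n\<close> absorbs the factor
    \<open>16 * c * r * k\<close>, so \<open>ln M\<close> and \<open>ln n\<close> agree up to a
    factor \<open>2\<close>.\<close>
  have "M \<le> n * n" unfolding M_def N_def using n(2) by (metis mult.assoc mult.commute mult_le_mono2)
  then have "ln (real M) \<le> ln (real n * real n)"
    using nM n(1) by (intro ln_mono) (auto simp flip: of_nat_mult)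
  also have "\<dots> = 2 * ln n" using n(1) by (simp add: ln_mult)
  finally have lnM: "ln M \<le> 2 * ln n" .
  have lnn: "ln n \<le> ln M" using nM n(1) by (intro ln_mono) auto
  have "exp 1 \<le> real n" using exp_le n(1) by linarith
  then have ln1: "1 \<le> ln n" using n(1) by (subst ln_ge_iff) auto
  have \<epsilon>: "0 < \<epsilon>" "\<epsilon> \<le> 1"
    using c r by (auto simp: \<epsilon>_def Suc_le_eq simp flip: of_nat_mult)
  have d_eq: "d = 16 * c * r * ln M" by (simp add: d_def \<epsilon>_def)
  have d0: "d > 0" using c r ln1 lnn by (simp add: d_eq)
  have dN: "d \<le> N"
  proof -
    have "ln M \<le> n" using lnM two_ln_le[of n] n(1) by simp
    then show ?thesis unfolding d_eq N_def by (simp add: mult_left_mono)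
  qed
  have D0: "D > 0" using N d0 by (simp add: D_def)
  have m_ge: "real M \<le> real m * ln M"
  proof -
    have "M / ln M \<le> real m" unfolding m_def by linarith
    then show ?thesis using ln1 lnn by (simp add: field_simps)
  qed
  have m_pos: "m > 0" using m_ge nM n(1) by (intro Nat.gr0I) auto
  \<comment> \<open>The hypothesis on \<open>ln n\<close> bounds the main term by \<open>n\<close>;
    a second \<open>n\<close> pays for rounding \<open>m\<close> up, by
    \<open>n \<ge> 2 * k\<^sup>2\<close>.\<close>
  have m_le: "2 * k * (k * m) \<le> 2 * real n"
  proof -
    have "real m \<le> M / ln M + 1" unfolding m_def using ln1 lnn by simp
    also have "\<dots> \<le> M / ln n + 1" using lnn ln1 by (simp add: frac_le)
    finally have "2 * real k ^ 2 * m \<le> 2 * real k ^ 2 * (M / ln n + 1)" by (intro mult_left_mono) auto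
    also have "\<dots> = (2 * k\<^sup>2 * (16 * c * r * k)) / ln n * n + 2 * real k ^ 2"
      by (simp add: M_eq algebra_simps)
    also have "\<dots> \<le> 1 * real n + n"
    proof (intro add_mono mult_right_mono)
      show "(2 * k\<^sup>2 * (16 * c * r * k)) / ln n \<le> 1"
        using ln_n ln1 by (subst divide_le_eq_1_pos) auto
      show "2 * (real k)\<^sup>2 \<le> real n" using n(3) by (simp flip: of_nat_power of_nat_le_iff)
    qed auto
    finally show ?thesis by (simp add: power2_eq_square mult_ac)
  qed
  obtain A where "quasirandom k N m \<epsilon> D d A"
    using exists_quasirandom[OF k _ _ \<epsilon> _ dN D_def, of m] m_ge nM n(1) d_def
    by (auto simp: M_def)
  then interpret quasirandom_digraph k N m \<epsilon> D d A
    using k D0 d0 by unfold_locales auto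
  have "arrows \<lparr>verts = UNIV, edges = cyc_edges k N A\<rparr> (tight_path k n) r"
  proof (rule arrows_tight_path[OF D0 d0 r m_pos N])
    show "0 \<le> \<epsilon>" using \<epsilon> by simp
    have "\<epsilon> * (2 * real r * real k * 4 ^ (2 * k - 3)) \<le> \<epsilon> * (2 * real r * real k * 4 ^ (2 * k))"
      using \<epsilon> by (intro mult_left_mono power_increasing diff_le_self) auto
    also have "\<dots> = 1" using r k by (simp add: \<epsilon>_def c_def)
    finally show "\<epsilon> * (2 * r * k * 4 ^ (2 * k - 3)) \<le> 1" by simp
    have "\<epsilon> * N / 4 = 4 * real n" using c r by (simp add: \<epsilon>_def N_def)
    then show "real (n + 2 * k * (k * m)) \<le> \<epsilon> * N / 4" using m_le by simp
    have "real (2 * k * (k * m)) * (2 * real r * 4 ^ (2 * k - 2)) \<le> (2 * real n) * (2 * real r * 4 ^ (2 * k))"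
      using m_le by (intro mult_mono mult_left_mono power_increasing diff_le_self) auto
    also have "\<dots> < real n * (32 * real k * real r * 4 ^ (2 * k))"
      using n(1) r k by simp
    also have "\<dots> = real N" by (simp add: N_def c_def)
    finally show "2 * k * (k * m) * (2 * r * 4 ^ (2 * k - 2)) < real N" by simp
  qed
  then have "size_Ramsey k (tight_path k n) r \<le> card (cyc_edges k N A)"
    by (rule size_Ramsey_le_card_H)
  then have "real (size_Ramsey k (tight_path k n) r) \<le> real (N * k) * ((4 * D) ^ (k - 2) * (4 * d))"
    using card_H_le by linarith
  also have "\<dots> = k * 4 ^ (k - 1) * (D ^ (k - 2) * (N * d))"
  proof -
    have "k - 1 = Suc (k - 2)" using k by simp
    then show ?thesis by (simp add: power_mult_distrib)
  qed
  \<comment> \<open>The codegree factor and the number of vertices supply the two missing powers of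
    \<open>D\<close>.\<close>
  also have "N * d = D ^ 2" using d0 by (simp add: D_def)
  also have "D ^ (k - 2) * D ^ 2 = D ^ k" using k by (simp only: power_add[symmetric] le_add_diff_inverse2)
  also have "k * 4 ^ (k - 1) * D ^ k \<le> k * 4 ^ (k - 1) * (32 * c * r * sqrt (n * ln n)) ^ k"
  proof (intro mult_left_mono power_mono)
    \<comment> \<open>\<open>ln M \<le> 2 * ln n\<close> is weakened to a factor \<open>4\<close>,
      whose square root is an integer.\<close>
    have "N * d \<le> (16 * c * r) ^ 2 * (4 * (n * ln n))"
    proof -
      have "N * d = (16 * c * r) ^ 2 * (n * ln M)"
        by (simp add: N_def d_eq power2_eq_square)
      also have "\<dots> \<le> (16 * c * r) ^ 2 * (n * (4 * ln n))"
        using lnM ln1 by (intro mult_left_mono) auto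
      finally show ?thesis by (simp add: algebra_simps)
    qed
    then have "D \<le> sqrt ((16 * c * r) ^ 2 * (4 * (n * ln n)))"
      unfolding D_def by (rule real_sqrt_le_mono)
    also have "\<dots> = 32 * c * r * sqrt (n * ln n)"
      by (simp add: real_sqrt_mult)
    finally show "D \<le> 32 * c * r * sqrt (n * ln n)" .
  qed (use D0 in auto)
  finally show ?thesis by simp
qed

theorem theorem1:
  fixes k :: nat
  assumes "k \<ge> 3"
  shows "\<exists>C::real. C > 0 \<and>
    (\<forall>r::nat. r \<ge> 2 \<longrightarrow>
      (\<forall>\<^sub>F n in sequentially.
        real (size_Ramsey k (tight_path k n) r)
          \<le> C * real r ^ k * (real n * ln (real n)) powr (real k / 2)))"
proof (intro exI conjI allI impI)
  define c where "c = 2 * k * 4 ^ (2 * k)"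
  let ?C = "k * 4 ^ (k - 1) * (32 * real c) ^ k"
  show "?C > 0" using assms by (simp add: c_def)
  fix r :: nat assume r: "r \<ge> 2"
  \<comment> \<open>The number \<open>r\<close> enters the threshold for \<open>n\<close>, while the
    constant \<open>?C\<close> depends on \<open>k\<close> alone.\<close>
  define K where "K = 8 + 16 * c * r * k + 2 * k\<^sup>2"
  have "filterlim (\<lambda>n. ln (real n)) at_top sequentially"
    by (rule filterlim_compose[OF ln_at_top filterlim_real_sequentially])
  then have "\<forall>\<^sub>F n in sequentially. ln (real n) \<ge> 2 * k\<^sup>2 * (16 * c * r * k)"
    by (simp add: filterlim_at_top)
  with eventually_ge_at_top[of K]
  show "\<forall>\<^sub>F n in sequentially. real (size_Ramsey k (tight_path k n) r)
      \<le> ?C * real r ^ k * (real n * ln (real n)) powr (real k / 2)"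
  proof eventually_elim
    case (elim n)
    then have n: "n \<ge> 8" "n \<ge> 16 * c * r * k" "n \<ge> 2 * k\<^sup>2" by (auto simp: K_def)
    have pos: "real n * ln (real n) > 0" using n(1) by simp
    have "sqrt (n * ln n) ^ k = (real n * ln (real n)) powr (real k / 2)"
    proof -
      have "sqrt (n * ln n) ^ k = sqrt (n * ln n) powr k" using pos by (simp add: powr_realpow)
      also have "\<dots> = ((n * ln n) powr (1 / 2)) powr k" using pos by (simp add: powr_half_sqrt)
      finally show ?thesis by (simp add: powr_powr)
    qed
    moreover have "size_Ramsey k (tight_path k n) r \<le>
        k * 4 ^ (k - 1) * (32 * c * r * sqrt (n * ln n)) ^ k"
      using size_Ramsey_tight_path_le[of k r n] assms r n elim(2) by (simp add: c_def)
    ultimately show ?case by (simp add: power_mult_distrib mult_ac)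
  qed
qed

end
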